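(* Assume that the family of conformity scores $\mathfrak{C}$ is stable. Furthermore, let $f_0>0$ be such that for all $n\in\mathbb{N}$ the conditional distribution of $y_1^{(n)}$ given $x_1^{(n)}=x$ is absolutely continuous for almost all $x\in\mathcal{X}_n$ with a density $f^{(n)}_{y|x}$ that is bounded from below by $f_0$ over $\mathcal{Y}_n$. Let $\lambda$ denote Lebesgue measure. General case: for all $\alpha\in(0,1)$, $\delta_1<\delta_2$ and $\epsilon\in(0,\min(\alpha,1-\alpha)]$, $$\lim_{n\to\infty}\mathbb{E}\big[\lambda\big(PS^{\mathrm{fc}}_{n,\alpha}(\delta_1)\setminus PS^{\mathrm{sc}}_{n,\alpha-\epsilon}(\delta_2)\big)\big]=0\quad\text{and}\quad\lim_{n\to\infty}\mathbb{E}\big[\lambda\big(PS^{\mathrm{sc}}_{n,\alpha+\epsilon}(\delta_1)\setminus PS^{\mathrm{fc}}_{n,\alpha}(\delta_2)\big)\big]=0 .$$ Continuous case: if, additionally, the CC assumption is fulfilled and $(\mathcal{C}_n(t_{n+1},\mathcal{T}_n))_{n\in\mathbb{N}}$ is stochastically bounded, then the expected length of the symmetric difference vanishes: $$\lim_{n\to\infty}\mathbb{E}\big[\lambda\big(PS^{\mathrm{fc}}_{n,\alpha}(0)\,\Delta\,PS^{\mathrm{sc}}_{n,\alpha}(0)\big)\big]=0\quad\text{for all }\alpha\in[0,1].$$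
   Context: Setting. For every $n\in\mathbb{N}$, $P_n$ is a regular Borel probability measure on $\mathcal{Z}_n=\mathcal{Y}_n\times\mathcal{X}_n$, where $\mathcal{Y}_n\subseteq\mathbb{R}$ is a (possibly unbounded) interval and $\mathcal{X}_n$ is a Euclidean space of dimension $p_n\in\mathbb{N}$. For each $n$, $t_i=t_i^{(n)}=(y_i,x_i)$, $1\le i\le n+1$, are i.i.d. with distribution $P_n$ (which may depend on $n$). Put $\mathcal{T}_n=(t_1,\dots,t_n)$, and let $\mathcal{T}_n^{\setminus i}$ denote $\mathcal{T}_n$ with $t_i$ removed. Conformity scores. $\mathfrak{C}=(\mathcal{C}^{(n)}_m)_{n,m\in\mathbb{N}}$ is a family of measurable functions $\mathcal{C}^{(n)}_m:\mathcal{Z}_n\times\mathcal{Z}_n^m\to\mathbb{R}$ that are symmetric in their second argument (invariant under permutations of the $m$ entries); the superscript $(n)$ is dropped. $\mathfrak{C}$ is called stable if $|\mathcal{C}_n(t_{n+1},\mathcal{T}_n)-\mathcal{C}_{n-1}(t_{n+1},\mathcal{T}_n^{\setminus n})|\to 0$ in probability as $n\to\infty$. Continuous case assumption (CC): for every $n\in\mathbb{N}$ and almost every $\mathcal{T}_n$, the distribution of $\mathcal{C}_n(t_{n+1},\mathcal{T}_n)$ conditional on $\mathcal{T}_n$ is absolutely continuous with density $f_{\mathcal{T}_n}$, and $(\|f_{\mathcal{T}_n}\|_\infty)_{n\in\mathbb{N}}$ is stochastically bounded, where $\|f\|_\infty=\sup_{x}|f(x)|$. Quantiles. For a cdf $F$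 and $\alpha\in\mathbb{R}$, $F^{-1}(\alpha)=\inf\{x\in\mathbb{R}:F(x)\ge\alpha\}\in[-\infty,\infty]$ with $\inf\emptyset=+\infty$. For real $c$, $c\le+\infty$ is true and $c\le-\infty$ is false. Full conformal prediction sets. For $y\in\mathcal{Y}_n$ let $\mathcal{D}_{n+1}^y=(t_1,\dots,t_n,(y,x_{n+1}))$ and $$\hat F_y(s)=\frac{1}{n+1}\mathds{1}\{\mathcal{C}_n((y,x_{n+1}),\mathcal{T}_n)\le s\}+\frac1{n+1}\sum_{i=1}^n\mathds{1}\{\mathcal{C}_n(t_i,\mathcal{D}_{n+1}^y\setminus t_i)\le s\},$$ where $\mathcal{D}_{n+1}^y\setminus t_i$ is $\mathcal{D}_{n+1}^y$ with its $i$-th entry removed. For $\alpha,\delta\in\mathbb{R}$, $PS^{\mathrm{fc}}_{n,\alpha}(\delta)=\{y\in\mathcal{Y}_n:\mathcal{C}_n((y,x_{n+1}),\mathcal{T}_n)\le\hat F_y^{-1}(1-\alpha)+\delta\}$. Shortcut prediction sets. $PS^{\mathrm{sc}}_{n,\alpha}(\delta)=\{y\in\mathcal{Y}_n:\mathcal{C}_n((y,x_{n+1}),\mathcal{T}_n)\le\hat G^{-1}(1-\alpha)+\delta\}$, where $\hat G(s)=\frac1n\sum_{i=1}^n\mathds{1}\{\mathcal{C}_{n-1}(t_i,\mathcal{T}_n^{\setminus i})\le s\}$. *)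

theory Defs
  imports "HOL-Probability.Probability" "HOL-Combinatorics.Permutations"
begin

text \<open>
  The dimension \<open>p\<close> of the feature space varies with the sample size, so a feature vector
  is an extensional function on \<open>{1..p}\<close>. The product \<open>\<sigma>\<close>-algebra used below is the Borel
  \<open>\<sigma>\<close>-algebra of the subspace \<open>Y \<times> \<real>\<^sup>p\<close> of \<open>\<real> \<times> \<real>\<^sup>p\<close>. Every
  probability measure on it is regular if \<open>Y\<close> is an interval.
\<close>

type_synonym point = "real \<times> (nat \<Rightarrow> real)"
type_synonym score = "point \<Rightarrow> (nat \<Rightarrow> point) \<Rightarrow> real"

definition x_space :: "nat \<Rightarrow> (nat \<Rightarrow> real) measure" where
  "x_space p = PiM {1..p} (\<lambda>_. borel)"

definition z_space :: "real set \<Rightarrow> nat \<Rightarrow> point measure" where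
  "z_space Y p = restrict_space borel Y \<Otimes>\<^sub>M x_space p"

definition tuple_space :: "real set \<Rightarrow> nat \<Rightarrow> nat \<Rightarrow> (nat \<Rightarrow> point) measure" where
  "tuple_space Y p m = PiM {1..m} (\<lambda>_. z_space Y p)"

definition train :: "(nat \<Rightarrow> nat \<Rightarrow> 'w \<Rightarrow> point) \<Rightarrow> nat \<Rightarrow> 'w \<Rightarrow> nat \<Rightarrow> point" where
  "train t n \<omega> = (\<lambda>i\<in>{1..n}. t n i \<omega>)"

text \<open>\<open>drop_entry m i T\<close> is the \<open>(m - 1)\<close>-tuple obtained from the \<open>m\<close>-tuple \<open>T\<close> by removing
  its \<open>i\<close>-th entry.\<close>

definition drop_entry :: "nat \<Rightarrow> nat \<Rightarrow> (nat \<Rightarrow> point) \<Rightarrow> nat \<Rightarrow> point" where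
  "drop_entry m i T = (\<lambda>j\<in>{1..m - 1}. if j < i then T j else T (Suc j))"

definition tendsto_zero_in_prob :: "(nat \<Rightarrow> 'w measure) \<Rightarrow> (nat \<Rightarrow> 'w \<Rightarrow> real) \<Rightarrow> bool" where
  "tendsto_zero_in_prob M X \<longleftrightarrow>
     (\<forall>e>0. (\<lambda>n. measure (M n) {\<omega> \<in> space (M n). \<bar>X n \<omega>\<bar> > e}) \<longlonglongrightarrow> 0)"

text \<open>
  \<open>X\<close> stands for absolute values, which may be infinite. The supremum norm of a random
  density need not be measurable, so the exceptional set is covered by an event \<open>A\<close>.
\<close>

definition stochastically_bounded :: "(nat \<Rightarrow> 'w measure) \<Rightarrow> (nat \<Rightarrow> 'w \<Rightarrow> ennreal) \<Rightarrow> bool" where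
  "stochastically_bounded M X \<longleftrightarrow>
     (\<forall>e>0. \<exists>K::real. \<forall>n\<ge>1. \<exists>A\<in>sets (M n).
        measure (M n) A \<le> e \<and> (\<forall>\<omega>\<in>space (M n) - A. X n \<omega> \<le> ennreal K))"

definition regular_cond_distr ::
  "'w measure \<Rightarrow> 'b measure \<Rightarrow> ('w \<Rightarrow> 'b) \<Rightarrow> 'a measure \<Rightarrow> ('w \<Rightarrow> 'a) \<Rightarrow> ('a \<Rightarrow> 'b measure) \<Rightarrow> bool"
where
  "regular_cond_distr M S X N V K \<longleftrightarrow>
     X \<in> measurable M S \<and> V \<in> measurable M N \<and> K \<in> measurable N (prob_algebra S) \<and>
     (\<forall>A\<in>sets N. \<forall>B\<in>sets S.
        emeasure M {\<omega> \<in> space M. V \<omega> \<in> A \<and> X \<omega> \<in> B}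
          = (\<integral>\<^sup>+ a \<in> A. emeasure (K a) B \<partial>distr M N V))"

definition has_cond_density ::
  "'w measure \<Rightarrow> ('w \<Rightarrow> real) \<Rightarrow> 'a measure \<Rightarrow> ('w \<Rightarrow> 'a) \<Rightarrow> ('a \<Rightarrow> real \<Rightarrow> ennreal) \<Rightarrow> bool"
where
  "has_cond_density M X N V f \<longleftrightarrow>
     (\<exists>K. regular_cond_distr M borel X N V K \<and>
        (AE a in distr M N V. f a \<in> borel_measurable borel \<and> K a = density lborel (f a)))"

definition conformity_scores ::
  "(nat \<Rightarrow> real set) \<Rightarrow> (nat \<Rightarrow> nat) \<Rightarrow> (nat \<Rightarrow> nat \<Rightarrow> score) \<Rightarrow> bool"
where
  "conformity_scores Y p C \<longleftrightarrow>
     (\<forall>n\<ge>1. \<forall>m\<ge>1.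
        (\<lambda>(z, T). C n m z T)
          \<in> borel_measurable (z_space (Y n) (p n) \<Otimes>\<^sub>M tuple_space (Y n) (p n) m) \<and>
        (\<forall>z\<in>space (z_space (Y n) (p n)). \<forall>T\<in>space (tuple_space (Y n) (p n) m).
           \<forall>\<pi>. \<pi> permutes {1..m} \<longrightarrow> C n m z (T \<circ> \<pi>) = C n m z T))"

definition test_score :: "(nat \<Rightarrow> nat \<Rightarrow> score) \<Rightarrow> (nat \<Rightarrow> nat \<Rightarrow> 'w \<Rightarrow> point) \<Rightarrow> nat \<Rightarrow> 'w \<Rightarrow> real" where
  "test_score C t n \<omega> = C n n (t n (Suc n) \<omega>) (train t n \<omega>)"

definition stable_scores ::
  "(nat \<Rightarrow> 'w measure) \<Rightarrow> (nat \<Rightarrow> nat \<Rightarrow> 'w \<Rightarrow> point) \<Rightarrow> (nat \<Rightarrow> nat \<Rightarrow> score) \<Rightarrow> bool"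
where
  "stable_scores M t C \<longleftrightarrow> tendsto_zero_in_prob M
     (\<lambda>n \<omega>. \<bar>C n n (t n (Suc n) \<omega>) (train t n \<omega>)
             - C n (n - 1) (t n (Suc n) \<omega>) (drop_entry n n (train t n \<omega>))\<bar>)"

definition CC ::
  "(nat \<Rightarrow> real set) \<Rightarrow> (nat \<Rightarrow> nat) \<Rightarrow> (nat \<Rightarrow> 'w measure) \<Rightarrow>
   (nat \<Rightarrow> nat \<Rightarrow> 'w \<Rightarrow> point) \<Rightarrow> (nat \<Rightarrow> nat \<Rightarrow> score) \<Rightarrow> bool"
where
  "CC Y p M t C \<longleftrightarrow>
     (\<exists>f :: nat \<Rightarrow> (nat \<Rightarrow> point) \<Rightarrow> real \<Rightarrow> ennreal.
        (\<forall>n\<ge>1. has_cond_density (M n) (test_score C t n)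
                  (tuple_space (Y n) (p n) n) (train t n) (f n)) \<and>
        stochastically_bounded M (\<lambda>n \<omega>. SUP s. f n (train t n \<omega>) s))"

definition quantile :: "(real \<Rightarrow> real) \<Rightarrow> real \<Rightarrow> ereal" where
  "quantile F \<alpha> = (INF x \<in> {x. F x \<ge> \<alpha>}. ereal x)"

text \<open>In the following \<open>T\<close> is a training sample of size \<open>n\<close> and \<open>x\<close> the new feature vector.\<close>

definition F_hat ::
  "(nat \<Rightarrow> nat \<Rightarrow> score) \<Rightarrow> nat \<Rightarrow> (nat \<Rightarrow> point) \<Rightarrow> (nat \<Rightarrow> real) \<Rightarrow> real \<Rightarrow> real \<Rightarrow> real"
where
  "F_hat C n T x y s =
     1 / real (n + 1) * of_bool (C n n (y, x) T \<le> s) +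
     1 / real (n + 1) *
       (\<Sum>i=1..n. of_bool (C n n (T i) (drop_entry (n + 1) i (T(n + 1 := (y, x)))) \<le> s))"

definition G_hat :: "(nat \<Rightarrow> nat \<Rightarrow> score) \<Rightarrow> nat \<Rightarrow> (nat \<Rightarrow> point) \<Rightarrow> real \<Rightarrow> real" where
  "G_hat C n T s =
     1 / real n * (\<Sum>i=1..n. of_bool (C n (n - 1) (T i) (drop_entry n i T) \<le> s))"

definition PS_fc ::
  "(nat \<Rightarrow> real set) \<Rightarrow> (nat \<Rightarrow> nat \<Rightarrow> score) \<Rightarrow> (nat \<Rightarrow> nat \<Rightarrow> 'w \<Rightarrow> point) \<Rightarrow>
   nat \<Rightarrow> real \<Rightarrow> real \<Rightarrow> 'w \<Rightarrow> real set"
where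
  "PS_fc Y C t n \<alpha> \<delta> \<omega> =
     (let T = train t n \<omega>; x = snd (t n (Suc n) \<omega>)
      in {y \<in> Y n. ereal (C n n (y, x) T) \<le> quantile (F_hat C n T x y) (1 - \<alpha>) + ereal \<delta>})"

definition PS_sc ::
  "(nat \<Rightarrow> real set) \<Rightarrow> (nat \<Rightarrow> nat \<Rightarrow> score) \<Rightarrow> (nat \<Rightarrow> nat \<Rightarrow> 'w \<Rightarrow> point) \<Rightarrow>
   nat \<Rightarrow> real \<Rightarrow> real \<Rightarrow> 'w \<Rightarrow> real set"
where
  "PS_sc Y C t n \<alpha> \<delta> \<omega> =
     (let T = train t n \<omega>; x = snd (t n (Suc n) \<omega>)
      in {y \<in> Y n. ereal (C n n (y, x) T) \<le> quantile (G_hat C n T) (1 - \<alpha>) + ereal \<delta>})"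

end

theory Submission
  imports Defs
begin

text \<open>
  Write \<open>S\<^sub>i = C\<^sub>n(t\<^sub>i, (t\<^sub>1, \<dots>, t\<^sub>n\<^sub>+\<^sub>1) without t\<^sub>i)\<close> for \<open>i \<le> n + 1\<close> and \<open>R\<^sub>i = C\<^sub>n\<^sub>-\<^sub>1(t\<^sub>i, T\<^sub>n without t\<^sub>i)\<close> for
  \<open>i \<le> n\<close>. The full conformal set compares \<open>S\<^sub>n\<^sub>+\<^sub>1\<close> with a quantile of the empirical cdf \<open>F\<close> of all
  the \<open>S\<^sub>i\<close>, the shortcut set compares it with a quantile of the empirical cdf \<open>G\<close> of the \<open>R\<^sub>i\<close>.

  Since the conditional density of the response is at least \<open>f\<^sub>0\<close>, the expected length of the set of
  those \<open>y\<close> for which an event occurs with \<open>y\<close> in place of the new response is at most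
  \<open>1 / f\<^sub>0\<close> times the probability of the event (\<open>length_le\<close>). It remains to bound probabilities.

  By exchangeability, \<open>(S\<^sub>i, R\<^sub>i)\<close> is distributed as the pair of scores that the definition of
  stability compares. So Markov's inequality shows that, outside an event of vanishing
  probability, at most \<open>n \<epsilon> / 2\<close> indices satisfy \<open>\<bar>S\<^sub>i - R\<^sub>i\<bar> > d\<close> (\<open>prob_deviates\<close>). On this good
  event \<open>G(s) - \<epsilon> \<le> F(s + d)\<close> and \<open>F(s) - \<epsilon> \<le> G(s + d)\<close> (\<open>emp_cdf_perturb\<close>), and the two set differences
  of the general case are empty for \<open>d = \<delta>\<^sub>2 - \<delta>\<^sub>1\<close> (\<open>prediction_inclusion\<close>).

  In the continuous case, a point of the symmetric difference forces on the good event that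
  \<open>F(S\<^sub>n\<^sub>+\<^sub>1 + 2d) \<ge> 1 - \<alpha> - \<epsilon>\<close> and \<open>F(S\<^sub>n\<^sub>+\<^sub>1 - 2d) < 1 - \<alpha> + \<epsilon>\<close>. By exchangeability, the probability of
  this is the expected fraction of indices \<open>i\<close> for which it holds with \<open>S\<^sub>i\<close>. Such scores lie, up
  to a fraction \<open>2\<epsilon>\<close> of the indices, in two intervals of length \<open>2d\<close>, and a cluster that contains a
  fraction \<open>q\<close> of the scores produces at least a fraction \<open>q\<^sup>2\<close> of pairs with \<open>\<bar>S\<^sub>i - S\<^sub>j\<bar> \<le> 2d\<close>
  (\<open>sum_straddles_le\<close>). Close pairs are rare: again by exchangeability it suffices to consider
  \<open>\<bar>S\<^sub>i - S\<^sub>n\<^sub>+\<^sub>1\<bar> \<le> 2d\<close>, and there \<open>S\<^sub>i\<close> may be replaced by \<open>R\<^sub>i\<close>, which is a function of the training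
  sample, so that the bounded conditional density of \<open>S\<^sub>n\<^sub>+\<^sub>1\<close> applies (\<open>prob_straddles\<close>,
  \<open>prob_close_le\<close>).
\<close>

section \<open>Empirical distribution functions and quantiles\<close>

text \<open>
  The empirical distribution function of \<open>v 1, \<dots>, v m\<close>.
\<close>

definition emp_cdf :: "nat \<Rightarrow> (nat \<Rightarrow> real) \<Rightarrow> real \<Rightarrow> real" where
  "emp_cdf m v s = (\<Sum>i=1..m. of_bool (v i \<le> s)) / real m"

lemma emp_cdf_mono: "s \<le> s' \<Longrightarrow> emp_cdf m v s \<le> emp_cdf m v s'"
  unfolding emp_cdf_def by (intro divide_right_mono sum_mono) auto

lemma emp_cdf_le_1: "emp_cdf m v s \<le> 1"
proof -
  have "(\<Sum>i=1..m. of_bool (v i \<le> s)) \<le> (\<Sum>i=1..m. (1::real))"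
    by (intro sum_mono) auto
  then show ?thesis
    by (cases "m = 0") (auto simp: emp_cdf_def divide_simps)
qed

lemma less_of_le_quantile:
  assumes "ereal c \<le> quantile F a + ereal d" and "s < c - d"
  shows "F s < a"
proof (rule ccontr)
  assume "\<not> F s < a"
  then have "quantile F a \<le> ereal s"
    unfolding quantile_def by (intro INF_lower) auto
  then have "quantile F a + ereal d \<le> ereal s + ereal d"
    by (rule add_right_mono)
  with assms(1) have "ereal c \<le> ereal s + ereal d"
    by (rule order_trans)
  with assms(2) show False by simp
qed

lemma ge_of_not_le_quantile:
  assumes "\<not> ereal c \<le> quantile F a + ereal d"
  obtains s where "s < c - d" "a \<le> F s"
proof -
  have "quantile F a < ereal (c - d)"
    using assms by (cases "quantile F a") auto
  then show thesis
    unfolding quantile_def INF_less_iff using that by auto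
qed

text \<open>
  If all but a fraction \<open>\<epsilon> / 2\<close> of the values move by at most \<open>d\<close>, and one more value is added, then
  the empirical cdf changes by at most \<open>\<epsilon>\<close> after a shift of its argument by \<open>d\<close>.
\<close>

lemma emp_cdf_perturb:
  fixes v w :: "nat \<Rightarrow> real"
  assumes n: "n \<ge> 1" "1 / real n \<le> \<epsilon> / 2"
    and bad: "(\<Sum>i=1..n. of_bool (\<bar>v i - w i\<bar> > d)) \<le> real n * \<epsilon> / 2"
  shows "emp_cdf n w s - \<epsilon> \<le> emp_cdf (Suc n) v (s + d)"
    and "emp_cdf (Suc n) v s - \<epsilon> \<le> emp_cdf n w (s + d)"
proof -
  define W where "W s = (\<Sum>i=1..n. of_bool (w i \<le> s) :: real)" for s
  define V where "V s = (\<Sum>i=1..n. of_bool (v i \<le> s) :: real)" for s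
  have W1: "W s \<le> real n" for s
    using emp_cdf_le_1[of n w s] n by (simp add: W_def emp_cdf_def divide_simps)
  have G: "emp_cdf n w s = W s / n" for s
    by (simp add: emp_cdf_def W_def)
  have F: "emp_cdf (Suc n) v s = (V s + of_bool (v (Suc n) \<le> s)) / (real n + 1)" for s
    by (simp add: emp_cdf_def V_def add.commute)
  have "W s \<le> V (s + d) + (\<Sum>i=1..n. of_bool (\<bar>v i - w i\<bar> > d))" for s
    unfolding W_def V_def sum.distrib[symmetric] by (intro sum_mono) auto
  with bad have WV: "W s \<le> V (s + d) + n * \<epsilon> / 2" for s
    by (meson add_left_mono order_trans)
  have "V s \<le> W (s + d) + (\<Sum>i=1..n. of_bool (\<bar>v i - w i\<bar> > d))" for s
    unfolding W_def V_def sum.distrib[symmetric] by (intro sum_mono) auto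
  with bad have VW: "V s \<le> W (s + d) + n * \<epsilon> / 2" for s
    by (meson add_left_mono order_trans)
  have n1: "1 \<le> real n * \<epsilon> / 2" using n by (simp add: field_simps)
  have eps: "0 \<le> \<epsilon>" using order_trans[of 0 "1 / real n" "\<epsilon> / 2"] n by simp
  have "(W s / n - \<epsilon>) * (real n + 1) \<le> V (s + d) + of_bool (v (Suc n) \<le> s + d)"
  proof -
    have "W s / n \<le> 1" using W1[of s] n by simp
    moreover have "(W s / n - \<epsilon>) * (real n + 1) = W s + W s / n - real n * \<epsilon> - \<epsilon>"
      using n by (simp add: field_simps)
    moreover have "(0::real) \<le> of_bool (v (Suc n) \<le> s + d)" by simp
    ultimately show ?thesis using WV[of s] n1 eps by linarith
  qed
  then show "emp_cdf n w s - \<epsilon> \<le> emp_cdf (Suc n) v (s + d)"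
    unfolding F G by (subst pos_le_divide_eq) auto
  have "V s + of_bool (v (Suc n) \<le> s) - real n * \<epsilon> \<le> W (s + d)"
  proof -
    have "of_bool (v (Suc n) \<le> s) \<le> (1::real)" by simp
    then show ?thesis using VW[of s] n1 by linarith
  qed
  moreover have "(V s + of_bool (v (Suc n) \<le> s)) / (real n + 1)
      \<le> (V s + of_bool (v (Suc n) \<le> s)) / real n"
    using n by (intro divide_left_mono) (auto simp: V_def intro!: add_nonneg_nonneg sum_nonneg)
  moreover have "(V s + of_bool (v (Suc n) \<le> s)) / real n \<le> (W (s + d) + real n * \<epsilon>) / real n"
    using calculation(1) by (intro divide_right_mono) auto
  moreover have "(W (s + d) + real n * \<epsilon>) / real n = W (s + d) / real n + \<epsilon>"
    using n by (simp add: add_divide_distrib)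
  ultimately show "emp_cdf (Suc n) v s - \<epsilon> \<le> emp_cdf n w (s + d)"
    unfolding F G by linarith
qed

text \<open>
  A cluster \<open>A\<close> of values of diameter at most \<open>d\<close> contributes \<open>(card A)\<^sup>2\<close> close pairs, so its size is
  controlled by the number of close pairs through \<open>x \<le> y + x\<^sup>2 / y\<close> with \<open>y = m \<eta>\<close>.
\<close>

lemma cluster_le_close_pairs:
  fixes v :: "nat \<Rightarrow> real"
  assumes m: "m \<ge> 1" and \<eta>: "\<eta> > 0" and A: "A \<subseteq> {1..m}"
    and close: "\<And>i j. i \<in> A \<Longrightarrow> j \<in> A \<Longrightarrow> \<bar>v i - v j\<bar> \<le> d"
  shows "real (card A)
    \<le> real m * \<eta> + (\<Sum>i=1..m. \<Sum>j=1..m. of_bool (\<bar>v i - v j\<bar> \<le> d)) / (real m * \<eta>)"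
proof -
  define x where "x = real (card A)"
  define y where "y = real m * \<eta>"
  have y: "y > 0" using m \<eta> by (simp add: y_def)
  have "finite A" using A finite_subset by blast
  have "x * x = (\<Sum>i\<in>A. \<Sum>j\<in>A. of_bool (\<bar>v i - v j\<bar> \<le> d))"
    using close by (simp add: x_def)
  also have "\<dots> \<le> (\<Sum>i\<in>A. \<Sum>j=1..m. of_bool (\<bar>v i - v j\<bar> \<le> d))"
    using A by (intro sum_mono sum_mono2) auto
  also have "\<dots> \<le> (\<Sum>i=1..m. \<Sum>j=1..m. of_bool (\<bar>v i - v j\<bar> \<le> d))"
    using A by (intro sum_mono2) (auto intro!: sum_nonneg)
  finally have N: "x * x / y \<le> (\<Sum>i=1..m. \<Sum>j=1..m. of_bool (\<bar>v i - v j\<bar> \<le> d)) / y"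
    using y by (intro divide_right_mono) auto
  have "0 \<le> (x - y)\<^sup>2 + x * y"
    using y by (simp add: x_def)
  then have "x \<le> y + x * x / y"
    using y by (simp add: field_simps power2_eq_square)
  with N show ?thesis
    unfolding x_def[symmetric] y_def[symmetric] by linarith
qed

text \<open>
  \<open>v i\<close> is, up to an error of \<open>d\<close> in the argument and of \<open>\<epsilon>\<close> in the level, an \<open>a\<close>-quantile of
  \<open>v 1, \<dots>, v m\<close>.
\<close>

definition straddles :: "nat \<Rightarrow> (nat \<Rightarrow> real) \<Rightarrow> real \<Rightarrow> real \<Rightarrow> real \<Rightarrow> nat \<Rightarrow> bool" where
  "straddles m v a \<epsilon> d i \<longleftrightarrow>
     a - \<epsilon> \<le> emp_cdf m v (v i + d) \<and> emp_cdf m v (v i - d) < a + \<epsilon>"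

text \<open>
  The straddling values are covered by two intervals of length \<open>d\<close>, at the smallest and at the
  largest of them, and by the gap in between, over which the empirical cdf grows by less than
  \<open>2\<epsilon>\<close>.
\<close>

lemma sum_straddles_le:
  fixes v :: "nat \<Rightarrow> real"
  assumes m: "m \<ge> 1" and \<epsilon>: "\<epsilon> > 0" and d: "d \<ge> 0"
  shows "(\<Sum>i=1..m. of_bool (straddles m v a \<epsilon> d i))
    \<le> 4 * real m * \<epsilon>
       + 2 / (real m * \<epsilon>) * (\<Sum>i=1..m. \<Sum>j=1..m. of_bool (\<bar>v i - v j\<bar> \<le> d))"
proof -
  define J where "J = {i\<in>{1..m}. straddles m v a \<epsilon> d i}"
  define N where "N = (\<Sum>i=1..m. \<Sum>j=1..m. of_bool (\<bar>v i - v j\<bar> \<le> d) :: real)"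
  have N0: "N \<ge> 0" unfolding N_def by (intro sum_nonneg) auto
  have cJ: "(\<Sum>i=1..m. of_bool (straddles m v a \<epsilon> d i)) = real (card J)"
    unfolding J_def by (simp add: sum_of_bool_eq Int_def)
  have "real (card J) \<le> 4 * real m * \<epsilon> + 2 / (real m * \<epsilon>) * N"
  proof (cases "J = {}")
    case True
    then show ?thesis using N0 \<epsilon> by simp
  next
    case False
    have fin: "finite J" by (simp add: J_def)
    define lo where "lo = Min (v ` J)"
    define hi where "hi = Max (v ` J)"
    have "lo \<in> v ` J" "hi \<in> v ` J"
      unfolding lo_def hi_def using fin False by (auto intro!: Min_in Max_in)
    then have lo: "a - \<epsilon> \<le> emp_cdf m v (lo + d)" and hi: "emp_cdf m v (hi - d) < a + \<epsilon>"
      by (auto simp: J_def straddles_def)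
    have rng: "lo \<le> v i" "v i \<le> hi" if "i \<in> J" for i
      using that fin by (auto simp: lo_def hi_def)
    define A where "A = {i\<in>{1..m}. lo \<le> v i \<and> v i \<le> lo + d}"
    define B where "B = {i\<in>{1..m}. lo + d < v i \<and> v i \<le> hi - d}"
    define H where "H = {i\<in>{1..m}. hi - d \<le> v i \<and> v i \<le> hi}"
    have "J \<subseteq> A \<union> B \<union> H"
      using rng by (auto simp: A_def B_def H_def J_def)
    then have "card J \<le> card (A \<union> B \<union> H)"
      by (intro card_mono) (auto simp: A_def B_def H_def)
    also have "\<dots> \<le> card A + card B + card H"
      by (meson add_mono card_Un_le le_refl order_trans)
    finally have J: "real (card J) \<le> real (card A) + real (card B) + real (card H)"
      by linarith
    have cA: "real (card A) \<le> real m * \<epsilon> + N / (real m * \<epsilon>)"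
      unfolding N_def using m \<epsilon> by (intro cluster_le_close_pairs) (auto simp: A_def)
    have cH: "real (card H) \<le> real m * \<epsilon> + N / (real m * \<epsilon>)"
      unfolding N_def using m \<epsilon> by (intro cluster_le_close_pairs) (auto simp: H_def)
    have cB: "real (card B) \<le> 2 * real m * \<epsilon>"
    proof (cases "lo + d \<le> hi - d")
      case True
      have "real (card B) = (\<Sum>i=1..m. of_bool (lo + d < v i \<and> v i \<le> hi - d))"
        unfolding B_def by (simp add: sum_of_bool_eq Int_def)
      also have "\<dots> = (\<Sum>i=1..m. of_bool (v i \<le> hi - d)) - (\<Sum>i=1..m. of_bool (v i \<le> lo + d))"
        unfolding sum_subtractf[symmetric] using True by (intro sum.cong) auto
      also have "\<dots> = real m * (emp_cdf m v (hi - d) - emp_cdf m v (lo + d))"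
        using m by (simp add: emp_cdf_def field_simps)
      also have "\<dots> \<le> real m * (2 * \<epsilon>)"
        using lo hi by (intro mult_left_mono) auto
      finally show ?thesis by simp
    next
      case False
      then have "B = {}" by (auto simp: B_def)
      then show ?thesis using \<epsilon> by simp
    qed
    have "2 / (real m * \<epsilon>) * N = N / (real m * \<epsilon>) + N / (real m * \<epsilon>)" by simp
    with J cA cB cH show ?thesis by linarith
  qed
  then show ?thesis unfolding cJ N_def .
qed

section \<open>Leave-one-out scores and permutations of the sample\<close>

text \<open>
  The permutation of \<open>{1..m}\<close> that sends \<open>m\<close> to \<open>i\<close> and is increasing on the other indices. It is
  chosen such that composing a sample with it makes \<open>drop_entry\<close> at the last index agree literally
  with \<open>drop_entry\<close> at index \<open>i\<close>.
\<close>

definition to_last :: "nat \<Rightarrow> nat \<Rightarrow> nat \<Rightarrow> nat" where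
  "to_last m i j = (if j = m then i else if i \<le> j \<and> j < m then Suc j else j)"

lemma to_last_permutes:
  assumes "i \<in> {1..m}"
  shows "to_last m i permutes {1..m}"
proof (rule bij_imp_permutes)
  have "inj_on (to_last m i) {1..m}"
    using assms by (auto simp: inj_on_def to_last_def split: if_splits)
  moreover have "to_last m i ` {1..m} \<subseteq> {1..m}"
    using assms by (auto simp: to_last_def)
  ultimately show "bij_betw (to_last m i) {1..m} {1..m}"
    by (simp add: bij_betw_def endo_inj_surj)
  show "to_last m i j = j" if "j \<notin> {1..m}" for j
    using that assms by (auto simp: to_last_def)
qed

text \<open>
  Permuting a sample and removing an entry amounts to removing the corresponding entry and
  permuting the rest; symmetric scores do not see the latter permutation.
\<close>

lemma drop_entry_permute:
  assumes \<pi>: "\<pi> permutes {1..m}" and j: "j \<in> {1..m}"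
  obtains \<sigma> where "\<sigma> permutes {1..m - 1}"
    "drop_entry m j (D \<circ> \<pi>) = drop_entry m (\<pi> j) D \<circ> \<sigma>"
proof -
  \<comment> \<open>\<open>skip i\<close> enumerates all indices except \<open>i\<close>.\<close>
  define skip :: "nat \<Rightarrow> nat \<Rightarrow> nat" where "skip i k = (if k < i then k else Suc k)" for i k
  have bij: "bij_betw (skip i) {1..m - 1} ({1..m} - {i})" if "i \<in> {1..m}" for i
  proof -
    have "inj_on (skip i) {1..m - 1}"
      by (auto simp: inj_on_def skip_def split: if_splits)
    moreover have "skip i ` {1..m - 1} \<subseteq> {1..m} - {i}"
      using that by (auto simp: skip_def)
    ultimately show ?thesis
      using that by (simp add: bij_betw_def card_subset_eq card_image)
  qed
  have \<pi>j: "\<pi> j \<in> {1..m}"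
    using permutes_in_image[OF \<pi>, of j] j by simp
  define \<tau> where "\<tau> = the_inv_into {1..m - 1} (skip (\<pi> j)) \<circ> \<pi> \<circ> skip j"
  have "bij_betw \<pi> ({1..m} - {j}) ({1..m} - {\<pi> j})"
    by (rule bij_betw_DiffI[OF permutes_imp_bij[OF \<pi>]]) (use j \<pi>j in \<open>auto simp: bij_betw_def\<close>)
  then have \<tau>: "bij_betw \<tau> {1..m - 1} {1..m - 1}"
    unfolding \<tau>_def using bij[OF j] bij_betw_the_inv_into[OF bij[OF \<pi>j]]
    by (auto intro!: bij_betw_trans)
  define \<sigma> where "\<sigma> k = (if k \<in> {1..m - 1} then \<tau> k else k)" for k
  have "bij_betw \<sigma> {1..m - 1} {1..m - 1}"
    by (rule iffD2[OF bij_betw_cong \<tau>]) (simp add: \<sigma>_def)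
  then have "\<sigma> permutes {1..m - 1}"
    by (rule bij_imp_permutes) (auto simp: \<sigma>_def)
  moreover have "drop_entry m j (D \<circ> \<pi>) = drop_entry m (\<pi> j) D \<circ> \<sigma>"
  proof
    fix k
    show "drop_entry m j (D \<circ> \<pi>) k = (drop_entry m (\<pi> j) D \<circ> \<sigma>) k"
    proof (cases "k \<in> {1..m - 1}")
      case True
      have "\<sigma> k \<in> {1..m - 1}"
        using \<tau> True by (auto simp: \<sigma>_def bij_betw_def)
      then have "(drop_entry m (\<pi> j) D \<circ> \<sigma>) k = D (skip (\<pi> j) (\<sigma> k))"
        by (simp add: drop_entry_def skip_def)
      also have "\<sigma> k = the_inv_into {1..m - 1} (skip (\<pi> j)) (\<pi> (skip j k))"
        using True by (simp add: \<sigma>_def \<tau>_def)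
      also have "skip (\<pi> j) \<dots> = \<pi> (skip j k)"
      proof (rule f_the_inv_into_f_bij_betw[OF bij[OF \<pi>j]])
        have "skip j k \<in> {1..m} - {j}"
          using bij_betw_apply[OF bij[OF j] True] .
        then show "\<pi> (skip j k) \<in> {1..m} - {\<pi> j}"
          using \<open>bij_betw \<pi> ({1..m} - {j}) _\<close> by (rule bij_betw_apply[rotated])
      qed
      finally show ?thesis
        using True by (simp add: drop_entry_def skip_def)
    next
      case False
      moreover from False have "\<sigma> k = k"
        unfolding \<sigma>_def by (rule if_not_P)
      ultimately show ?thesis
        by (simp only: drop_entry_def o_apply restrict_apply if_False)
    qed
  qed
  ultimately show thesis by (rule that)
qed

text \<open>
  The leave-one-out score of the \<open>i\<close>-th entry of an \<open>m\<close>-tuple.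
\<close>

definition loo_score :: "score \<Rightarrow> nat \<Rightarrow> (nat \<Rightarrow> point) \<Rightarrow> nat \<Rightarrow> real" where
  "loo_score c m D i = c (D i) (drop_entry m i D)"

lemma emp_cdf_permute:
  assumes "\<pi> permutes {1..m}" and "\<And>j. j \<in> {1..m} \<Longrightarrow> v' j = v (\<pi> j)"
  shows "emp_cdf m v' s = emp_cdf m v s"
proof -
  have "(\<Sum>i=1..m. of_bool (v' i \<le> s) :: real) = (\<Sum>i=1..m. of_bool (v (\<pi> i) \<le> s))"
    using assms(2) by (intro sum.cong) auto
  also have "\<dots> = (\<Sum>i=1..m. of_bool (v i \<le> s))"
    using sum.permute[OF assms(1), of "\<lambda>i. of_bool (v i \<le> s) :: real"] by (simp add: o_def)
  finally show ?thesis by (simp add: emp_cdf_def)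
qed

lemma straddles_permute:
  assumes "\<pi> permutes {1..m}" and "\<And>j. j \<in> {1..m} \<Longrightarrow> v' j = v (\<pi> j)" and "j \<in> {1..m}"
  shows "straddles m v' a \<epsilon> d j = straddles m v a \<epsilon> d (\<pi> j)"
  using emp_cdf_permute[of \<pi> m v' v, OF assms(1,2)] assms(3) by (simp add: straddles_def assms(2))

lemma measurable_score_drop_entry:
  assumes c: "(\<lambda>(z, T). c z T) \<in> borel_measurable (P \<Otimes>\<^sub>M PiM {1..m - 1} (\<lambda>_. P))"
    and I: "{1..m} \<subseteq> I" and k: "k \<in> I"
  shows "(\<lambda>D. c (D k) (drop_entry m i D)) \<in> borel_measurable (PiM I (\<lambda>_. P))"
proof -
  have comp: "(\<lambda>D. D j) \<in> PiM I (\<lambda>_. P) \<rightarrow>\<^sub>M P" if "j \<in> I" for j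
    using that by (intro measurable_component_singleton) auto
  have "(\<lambda>D. drop_entry m i D) \<in> PiM I (\<lambda>_. P) \<rightarrow>\<^sub>M PiM {1..m - 1} (\<lambda>_. P)"
    unfolding drop_entry_def
  proof (rule measurable_restrict)
    fix j assume "j \<in> {1..m - 1}"
    then have "j \<in> I" "Suc j \<in> I" using I by auto
    then show "(\<lambda>D. if j < i then D j else D (Suc j)) \<in> PiM I (\<lambda>_. P) \<rightarrow>\<^sub>M P"
      by (cases "j < i") (auto intro: comp)
  qed
  then have "(\<lambda>D. (D k, drop_entry m i D)) \<in> PiM I (\<lambda>_. P) \<rightarrow>\<^sub>M P \<Otimes>\<^sub>M PiM {1..m - 1} (\<lambda>_. P)"
    using comp[OF k] by (rule measurable_Pair[rotated])
  from measurable_compose[OF this c] show ?thesis by simp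
qed

lemma (in prob_space) of_bool_expectation:
  assumes [measurable]: "Measurable.pred M Q"
  shows "integrable M (\<lambda>x. of_bool (Q x) :: real)"
    and "expectation (\<lambda>x. of_bool (Q x)) = prob {x \<in> space M. Q x}"
proof -
  have ind: "of_bool (Q x) = (indicator {x \<in> space M. Q x} x :: real)" if "x \<in> space M" for x
    using that by (auto simp: indicator_def)
  have "integrable M (indicator {x \<in> space M. Q x} :: _ \<Rightarrow> real)"
    by (intro integrable_real_indicator) (auto simp: emeasure_eq_measure)
  then show "integrable M (\<lambda>x. of_bool (Q x) :: real)"
    by (subst Bochner_Integration.integrable_cong[OF refl ind]) auto
  show "expectation (\<lambda>x. of_bool (Q x)) = prob {x \<in> space M. Q x}"
    by (subst Bochner_Integration.integral_cong[OF refl ind]) auto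
qed

section \<open>Exchangeability bounds for a sample of fixed size\<close>

text \<open>
  A sample of \<open>n + 1\<close> independent points with law \<open>P\<close>, represented by the product measure, with a
  symmetric score \<open>c\<close> for training samples of size \<open>n\<close> and a score \<open>c'\<close> for training samples of size
  \<open>n - 1\<close>.
\<close>

locale sample_scores = prob_space P for P :: "point measure" +
  fixes n :: nat and c c' :: score
  assumes n_ge: "2 \<le> n"
    and c_meas: "(\<lambda>(z, T). c z T) \<in> borel_measurable (P \<Otimes>\<^sub>M PiM {1..n} (\<lambda>_. P))"
    and c'_meas: "(\<lambda>(z, T). c' z T) \<in> borel_measurable (P \<Otimes>\<^sub>M PiM {1..n - 1} (\<lambda>_. P))"
    and c_sym: "\<And>z T \<sigma>. z \<in> space P \<Longrightarrow> T \<in> space (PiM {1..n} (\<lambda>_. P)) \<Longrightarrow>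
      \<sigma> permutes {1..n} \<Longrightarrow> c z (T \<circ> \<sigma>) = c z T"
begin

abbreviation "Samples \<equiv> PiM {1..Suc n} (\<lambda>_. P)"

sublocale S: prob_space Samples
  by (intro prob_space_PiM) (rule prob_space_axioms)

text \<open>
  The scores \<open>S\<^sub>i\<close> that enter the full conformal empirical cdf; the new point has index \<open>Suc n\<close>.
\<close>

definition fc_score :: "(nat \<Rightarrow> point) \<Rightarrow> nat \<Rightarrow> real" where
  "fc_score = loo_score c (Suc n)"

text \<open>
  The scores \<open>R\<^sub>i\<close>, \<open>i \<le> n\<close>, that enter the shortcut empirical cdf.
\<close>

definition sc_score :: "(nat \<Rightarrow> point) \<Rightarrow> nat \<Rightarrow> real" where
  "sc_score = loo_score c' n"

text \<open>
  The probability that tends to zero for stable scores: the score of the new point changes by more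
  than \<open>d\<close> when the last training point is removed.
\<close>

definition instability :: "real \<Rightarrow> real" where
  "instability d = S.prob {D \<in> space Samples.
     \<bar>fc_score D (Suc n) - c' (D (Suc n)) (drop_entry n n D)\<bar> > d}"

lemma measurable_fc_score [measurable]:
  "i \<in> {1..Suc n} \<Longrightarrow> (\<lambda>D. fc_score D i) \<in> borel_measurable Samples"
  unfolding fc_score_def loo_score_def using c_meas by (intro measurable_score_drop_entry) auto

lemma measurable_sc_score:
  "i \<in> {1..n} \<Longrightarrow> {1..n} \<subseteq> I \<Longrightarrow> (\<lambda>D. sc_score D i) \<in> borel_measurable (PiM I (\<lambda>_. P))"
  unfolding sc_score_def loo_score_def using c'_meas by (intro measurable_score_drop_entry) auto

lemma measurable_sc_score_Samples [measurable]:
  "i \<in> {1..n} \<Longrightarrow> (\<lambda>D. sc_score D i) \<in> borel_measurable Samples"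
  by (rule measurable_sc_score) auto

lemma measurable_sc_score_new [measurable]:
  "(\<lambda>D. c' (D (Suc n)) (drop_entry n n D)) \<in> borel_measurable Samples"
  using c'_meas by (intro measurable_score_drop_entry) auto

lemma distr_permute:
  assumes "\<pi> permutes {1..Suc n}"
  shows "(\<lambda>D. D \<circ> \<pi>) \<in> Samples \<rightarrow>\<^sub>M Samples" and "distr Samples Samples (\<lambda>D. D \<circ> \<pi>) = Samples"
proof -
  have eq: "(\<lambda>j\<in>{1..Suc n}. D (\<pi> j)) = D \<circ> \<pi>" if "D \<in> space Samples" for D
  proof
    fix j
    show "(\<lambda>j\<in>{1..Suc n}. D (\<pi> j)) j = (D \<circ> \<pi>) j"
    proof (cases "j \<in> {1..Suc n}")
      case False
      then have "\<pi> j = j" using assms by (simp add: permutes_def)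
      then show ?thesis using False that by (auto simp: space_PiM PiE_def extensional_def)
    qed simp
  qed
  have \<pi>: "\<pi> j \<in> {1..Suc n}" if "j \<in> {1..Suc n}" for j
    using permutes_in_image[OF assms, of j] that by blast
  have "(\<lambda>D. \<lambda>j\<in>{1..Suc n}. D (\<pi> j)) \<in> Samples \<rightarrow>\<^sub>M Samples"
    using \<pi> by (intro measurable_restrict measurable_component_singleton) auto
  then show "(\<lambda>D. D \<circ> \<pi>) \<in> Samples \<rightarrow>\<^sub>M Samples"
    by (subst measurable_cong[OF eq[symmetric]])
  have "distr Samples Samples (\<lambda>D. \<lambda>j\<in>{1..Suc n}. D (\<pi> j)) = Samples"
    using \<pi> prob_space_axioms
    by (intro distr_PiM_reindex[of "{1..Suc n}" "\<lambda>_. P" \<pi> "{1..Suc n}"])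
      (auto intro: permutes_inj_on[OF assms])
  then show "distr Samples Samples (\<lambda>D. D \<circ> \<pi>) = Samples"
    by (subst distr_cong[OF refl refl eq[symmetric]])
qed

lemma expectation_permute:
  fixes f :: "_ \<Rightarrow> real"
  assumes "\<pi> permutes {1..Suc n}" and "f \<in> borel_measurable Samples"
  shows "S.expectation (\<lambda>D. f (D \<circ> \<pi>)) = S.expectation f"
  using integral_distr[OF distr_permute(1)[OF assms(1)] assms(2)] distr_permute(2)[OF assms(1)]
  by simp

lemma fc_score_permute:
  assumes D: "D \<in> space Samples" and \<pi>: "\<pi> permutes {1..Suc n}" and j: "j \<in> {1..Suc n}"
  shows "fc_score (D \<circ> \<pi>) j = fc_score D (\<pi> j)"
proof -
  obtain \<sigma> where \<sigma>: "\<sigma> permutes {1..n}"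
      "drop_entry (Suc n) j (D \<circ> \<pi>) = drop_entry (Suc n) (\<pi> j) D \<circ> \<sigma>"
    using drop_entry_permute[OF \<pi> j, of D] by auto
  have "\<pi> j \<in> {1..Suc n}"
    using permutes_in_image[OF \<pi>, of j] j by blast
  moreover have "drop_entry (Suc n) (\<pi> j) D \<in> space (PiM {1..n} (\<lambda>_. P))"
    using D by (fastforce simp: space_PiM PiE_def Pi_def drop_entry_def)
  ultimately show ?thesis
    using \<sigma> D by (simp add: fc_score_def loo_score_def c_sym space_PiM PiE_def Pi_def)
qed

lemma pred_deviation [measurable]:
  "i \<in> {1..n} \<Longrightarrow> Measurable.pred Samples (\<lambda>D. \<bar>fc_score D i - sc_score D i\<bar> > d)"
  by measurable

lemma prob_deviation:
  assumes i: "i \<in> {1..n}"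
  shows "S.prob {D \<in> space Samples. \<bar>fc_score D i - sc_score D i\<bar> > d} = instability d"
proof -
  define \<pi> where "\<pi> = to_last (Suc n) i"
  have \<pi>: "\<pi> permutes {1..Suc n}"
    unfolding \<pi>_def using i by (intro to_last_permutes) auto
  have 1: "drop_entry (Suc n) (Suc n) (D \<circ> \<pi>) = drop_entry (Suc n) i D"
    and 2: "drop_entry n n (D \<circ> \<pi>) = drop_entry n i D" for D
    by (auto simp: drop_entry_def \<pi>_def to_last_def restrict_def fun_eq_iff)
  define q where "q D \<longleftrightarrow> \<bar>fc_score D (Suc n) - c' (D (Suc n)) (drop_entry n n D)\<bar> > d" for D
  have q: "Measurable.pred Samples q"
    unfolding q_def by measurable
  have q\<pi>: "q (D \<circ> \<pi>) \<longleftrightarrow> \<bar>fc_score D i - sc_score D i\<bar> > d" for D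
    by (simp add: q_def fc_score_def sc_score_def loo_score_def 1 2) (simp add: \<pi>_def to_last_def)
  have "instability d = S.expectation (\<lambda>D. of_bool (q D))"
    unfolding instability_def q_def[symmetric] by (rule S.of_bool_expectation(2)[OF q, symmetric])
  also have "\<dots> = S.expectation (\<lambda>D. of_bool (q (D \<circ> \<pi>)))"
    using borel_measurable_integrable[OF S.of_bool_expectation(1)[OF q]]
    by (rule expectation_permute[OF \<pi>, symmetric])
  also have "\<dots> = S.prob {D \<in> space Samples. \<bar>fc_score D i - sc_score D i\<bar> > d}"
    unfolding q\<pi> by (rule S.of_bool_expectation(2)[OF pred_deviation[OF i]])
  finally show ?thesis by simp
qed

text \<open>
  The bad event that more than a fraction \<open>\<epsilon> / 2\<close> of the scores differ by more than \<open>d\<close> between the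
  two methods.
\<close>

definition deviates :: "real \<Rightarrow> real \<Rightarrow> (nat \<Rightarrow> point) \<Rightarrow> bool" where
  "deviates \<epsilon> d D \<longleftrightarrow> (\<Sum>i=1..n. of_bool (\<bar>fc_score D i - sc_score D i\<bar> > d)) > real n * \<epsilon> / 2"

lemma pred_deviates [measurable]: "Measurable.pred Samples (deviates \<epsilon> d)"
  unfolding deviates_def by measurable

lemma prob_deviates:
  assumes "\<epsilon> > 0"
  shows "S.prob {D \<in> space Samples. deviates \<epsilon> d D} \<le> 2 / \<epsilon> * instability d"
proof -
  have "real n * \<epsilon> / 2 * S.prob {D \<in> space Samples. deviates \<epsilon> d D}
      = S.expectation (\<lambda>D. real n * \<epsilon> / 2 * of_bool (deviates \<epsilon> d D))"
    by (simp only: integral_mult_right_zero S.of_bool_expectation(2)[OF pred_deviates])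
  also have "\<dots> \<le> S.expectation (\<lambda>D. \<Sum>i=1..n. of_bool (\<bar>fc_score D i - sc_score D i\<bar> > d))"
  proof (rule integral_mono)
    show "integrable Samples (\<lambda>D. real n * \<epsilon> / 2 * of_bool (deviates \<epsilon> d D))"
      by (intro integrable_mult_right S.of_bool_expectation(1) pred_deviates)
    show "integrable Samples (\<lambda>D. \<Sum>i=1..n. of_bool (\<bar>fc_score D i - sc_score D i\<bar> > d) :: real)"
      by (intro Bochner_Integration.integrable_sum S.of_bool_expectation(1)[OF pred_deviation])
    show "real n * \<epsilon> / 2 * of_bool (deviates \<epsilon> d D)
        \<le> (\<Sum>i=1..n. of_bool (\<bar>fc_score D i - sc_score D i\<bar> > d))" for D
      by (auto simp: deviates_def intro: sum_nonneg)
  qed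
  also have "\<dots> = (\<Sum>i=1..n. S.expectation (\<lambda>D. of_bool (\<bar>fc_score D i - sc_score D i\<bar> > d)))"
    by (intro Bochner_Integration.integral_sum S.of_bool_expectation(1)[OF pred_deviation])
  also have "\<dots> = (\<Sum>i=1..n. instability d)"
    by (intro sum.cong refl)
      (simp only: S.of_bool_expectation(2)[OF pred_deviation] prob_deviation)
  finally show ?thesis
    using assms n_ge by (simp add: field_simps)
qed

lemma exchangeable_expectation:
  fixes g :: "(nat \<Rightarrow> point) \<Rightarrow> nat \<Rightarrow> real"
  assumes meas: "(\<lambda>D. g D (Suc n)) \<in> borel_measurable Samples"
    and equivariant: "\<And>D \<pi>. D \<in> space Samples \<Longrightarrow> \<pi> permutes {1..Suc n} \<Longrightarrow>
      g (D \<circ> \<pi>) (Suc n) = g D (\<pi> (Suc n))"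
    and i: "i \<in> {1..Suc n}"
  shows "S.expectation (\<lambda>D. g D i) = S.expectation (\<lambda>D. g D (Suc n))"
proof -
  define \<pi> where "\<pi> = to_last (Suc n) i"
  have \<pi>: "\<pi> permutes {1..Suc n}"
    unfolding \<pi>_def using i by (rule to_last_permutes)
  have "S.expectation (\<lambda>D. g D (Suc n)) = S.expectation (\<lambda>D. g (D \<circ> \<pi>) (Suc n))"
    by (rule expectation_permute[OF \<pi> meas, symmetric])
  also have "\<dots> = S.expectation (\<lambda>D. g D i)"
    using equivariant[OF _ \<pi>]
    by (intro Bochner_Integration.integral_cong refl) (simp add: \<pi>_def to_last_def)
  finally show ?thesis by simp
qed

lemma pred_close [measurable]:
  "i \<in> {1..Suc n} \<Longrightarrow> j \<in> {1..Suc n} \<Longrightarrow>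
    Measurable.pred Samples (\<lambda>D. \<bar>fc_score D i - fc_score D j\<bar> \<le> d)"
  by measurable

lemma measurable_emp_cdf_fc_score [measurable]:
  assumes [measurable]: "f \<in> borel_measurable Samples"
  shows "(\<lambda>D. emp_cdf (Suc n) (fc_score D) (f D)) \<in> borel_measurable Samples"
  unfolding emp_cdf_def
proof (intro borel_measurable_divide borel_measurable_sum borel_measurable_const)
  fix i assume "i \<in> {1..Suc n}"
  then have "(\<lambda>D. fc_score D i) \<in> borel_measurable Samples"
    by (rule measurable_fc_score)
  then have "Measurable.pred Samples (\<lambda>D. fc_score D i \<le> f D)"
    unfolding pred_def using assms by (intro borel_measurable_le) 
  then show "(\<lambda>D. of_bool (fc_score D i \<le> f D) :: real) \<in> borel_measurable Samples"
    by (rule measurable_compose) (rule measurable_of_bool)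
qed

lemma pred_straddles [measurable]:
  assumes "i \<in> {1..Suc n}"
  shows "Measurable.pred Samples (\<lambda>D. straddles (Suc n) (fc_score D) a \<epsilon> d i)"
proof -
  have [measurable]: "(\<lambda>D. fc_score D i) \<in> borel_measurable Samples"
    using assms by (rule measurable_fc_score)
  show ?thesis unfolding straddles_def by measurable
qed

text \<open>
  All points contribute equally many close pairs on average. For the new point, \<open>S\<^sub>i\<close> may be replaced
  by \<open>R\<^sub>i\<close>, at the price of the instability and of enlarging the distance from \<open>2d\<close> to \<open>3d\<close>. The
  summand \<open>1\<close> is the pair of the new point with itself.
\<close>

lemma expected_close_pairs:
  assumes close: "\<And>i. i \<in> {1..n} \<Longrightarrow>
      S.prob {D \<in> space Samples. \<bar>fc_score D (Suc n) - sc_score D i\<bar> \<le> 3 * d} \<le> \<kappa>"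
    and d: "d \<ge> 0"
  shows "S.expectation (\<lambda>D. \<Sum>i=1..Suc n. \<Sum>j=1..Suc n. of_bool (\<bar>fc_score D i - fc_score D j\<bar> \<le> 2 * d))
    \<le> real (Suc n) * (1 + real n * (instability d + \<kappa>))"
proof -
  define N where "N D i = (\<Sum>j=1..Suc n. of_bool (\<bar>fc_score D i - fc_score D j\<bar> \<le> 2 * d) :: real)" for D i
  have int_N: "integrable Samples (\<lambda>D. N D i)" if "i \<in> {1..Suc n}" for i
    unfolding N_def using that
    by (intro Bochner_Integration.integrable_sum S.of_bool_expectation(1) pred_close)
  have N_permute: "N (D \<circ> \<pi>) (Suc n) = N D (\<pi> (Suc n))"
    if "D \<in> space Samples" and \<pi>: "\<pi> permutes {1..Suc n}" for D \<pi>
  proof -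
    have "N (D \<circ> \<pi>) (Suc n)
        = (\<Sum>j=1..Suc n. of_bool (\<bar>fc_score D (\<pi> (Suc n)) - fc_score D (\<pi> j)\<bar> \<le> 2 * d))"
      unfolding N_def using fc_score_permute[OF that] by (intro sum.cong refl) (simp del: sum.cl_ivl_Suc)
    also have "\<dots> = N D (\<pi> (Suc n))"
      unfolding N_def
      using sum.permute[OF \<pi>, of "\<lambda>j. of_bool (\<bar>fc_score D (\<pi> (Suc n)) - fc_score D j\<bar> \<le> 2 * d) :: real"]
      by (simp only: o_def)
    finally show ?thesis .
  qed
  have N_eq: "S.expectation (\<lambda>D. N D i) = S.expectation (\<lambda>D. N D (Suc n))"
    if "i \<in> {1..Suc n}" for i
    by (rule exchangeable_expectation[where g = N, OF borel_measurable_integrable[OF int_N] N_permute])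
      (use that in simp_all)
  have pred_sc_score: "Measurable.pred Samples (\<lambda>D. \<bar>fc_score D (Suc n) - sc_score D i\<bar> \<le> 3 * d)"
    if "i \<in> {1..n}" for i
  proof -
    have [measurable]: "(\<lambda>D. sc_score D i) \<in> borel_measurable Samples"
      using that by (rule measurable_sc_score_Samples)
    show ?thesis by measurable
  qed
  let ?far = "\<lambda>i D. of_bool (\<bar>fc_score D i - sc_score D i\<bar> > d) :: real"
  let ?near = "\<lambda>i D. of_bool (\<bar>fc_score D (Suc n) - sc_score D i\<bar> \<le> 3 * d) :: real"
  have int: "integrable Samples (?far i)" "integrable Samples (?near i)" if "i \<in> {1..n}" for i
    using S.of_bool_expectation(1)[OF pred_deviation[OF that]]
      S.of_bool_expectation(1)[OF pred_sc_score[OF that]] by blast+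
  have int_sum: "integrable Samples (\<lambda>D. \<Sum>i=1..n. ?far i D + ?near i D)"
    using int by (intro Bochner_Integration.integrable_sum Bochner_Integration.integrable_add)
  have "S.expectation (\<lambda>D. N D (Suc n))
      \<le> S.expectation (\<lambda>D. 1 + (\<Sum>i=1..n. ?far i D + ?near i D))"
  proof (rule integral_mono)
    show "integrable Samples (\<lambda>D. N D (Suc n))" by (rule int_N) simp
    show "integrable Samples (\<lambda>D. 1 + (\<Sum>i=1..n. ?far i D + ?near i D))"
      using int_sum by (intro Bochner_Integration.integrable_add S.integrable_const)
    fix D
    have "N D (Suc n) = 1 + (\<Sum>i=1..n. of_bool (\<bar>fc_score D (Suc n) - fc_score D i\<bar> \<le> 2 * d))"
      using d by (simp add: N_def)
    also have "\<dots> \<le> 1 + (\<Sum>i=1..n. ?far i D + ?near i D)"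
      by (intro add_left_mono sum_mono) auto
    finally show "N D (Suc n) \<le> 1 + (\<Sum>i=1..n. ?far i D + ?near i D)" .
  qed
  also have "\<dots> = 1 + S.expectation (\<lambda>D. \<Sum>i=1..n. ?far i D + ?near i D)"
    using Bochner_Integration.integral_add[OF S.integrable_const[of "1::real"] int_sum]
    by (simp only: S.prob_space Bochner_Integration.lebesgue_integral_const scaleR_one)
  also have "S.expectation (\<lambda>D. \<Sum>i=1..n. ?far i D + ?near i D)
      = (\<Sum>i=1..n. S.expectation (\<lambda>D. ?far i D + ?near i D))"
    using int by (intro Bochner_Integration.integral_sum Bochner_Integration.integrable_add)
  also have "\<dots> \<le> (\<Sum>i=1..n. instability d + \<kappa>)"
  proof (intro sum_mono)
    fix i assume i: "i \<in> {1..n}"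
    have "S.expectation (\<lambda>D. ?far i D + ?near i D)
        = S.expectation (?far i) + S.expectation (?near i)"
      by (rule Bochner_Integration.integral_add[OF int[OF i]])
    then show "S.expectation (\<lambda>D. ?far i D + ?near i D) \<le> instability d + \<kappa>"
      unfolding S.of_bool_expectation(2)[OF pred_deviation[OF i]]
        S.of_bool_expectation(2)[OF pred_sc_score[OF i]] prob_deviation[OF i]
      using close[OF i] by linarith
  qed
  finally have N_le: "S.expectation (\<lambda>D. N D (Suc n)) \<le> 1 + real n * (instability d + \<kappa>)"
    by simp
  have "S.expectation (\<lambda>D. \<Sum>i=1..Suc n. N D i) = (\<Sum>i=1..Suc n. S.expectation (\<lambda>D. N D i))"
    using int_N by (intro Bochner_Integration.integral_sum)
  also have "\<dots> = (\<Sum>i=1..Suc n. S.expectation (\<lambda>D. N D (Suc n)))"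
    using N_eq by (intro sum.cong refl)
  also have "\<dots> = real (Suc n) * S.expectation (\<lambda>D. N D (Suc n))"
    by (simp only: sum_constant card_atLeastAtMost diff_Suc_1)
  also have "\<dots> \<le> real (Suc n) * (1 + real n * (instability d + \<kappa>))"
    using N_le by (intro mult_left_mono) auto
  finally show ?thesis unfolding N_def .
qed

lemma prob_straddles:
  assumes \<epsilon>: "\<epsilon> > 0" and d: "d \<ge> 0"
    and close: "\<And>i. i \<in> {1..n} \<Longrightarrow>
      S.prob {D \<in> space Samples. \<bar>fc_score D (Suc n) - sc_score D i\<bar> \<le> 3 * d} \<le> \<kappa>"
  shows "S.prob {D \<in> space Samples. straddles (Suc n) (fc_score D) a \<epsilon> (2 * d) (Suc n)}
    \<le> 4 * \<epsilon> + 2 / \<epsilon> * (1 / real (Suc n) + instability d + \<kappa>)"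
proof -
  let ?E = "\<lambda>D. straddles (Suc n) (fc_score D) a \<epsilon> (2 * d)"
  define m where "m = real (Suc n)"
  have m: "m > 0" by (simp add: m_def)
  have int: "integrable Samples (\<lambda>D. of_bool (?E D i) :: real)" if "i \<in> {1..Suc n}" for i
    using that by (intro S.of_bool_expectation(1) pred_straddles)
  have eq: "S.expectation (\<lambda>D. of_bool (?E D i) :: real) = S.expectation (\<lambda>D. of_bool (?E D (Suc n)))"
    if "i \<in> {1..Suc n}" for i
  proof (rule exchangeable_expectation[where g = "\<lambda>D i. of_bool (?E D i)", OF _ _ that])
    show "(\<lambda>D. of_bool (?E D (Suc n)) :: real) \<in> borel_measurable Samples"
      by (intro borel_measurable_integrable int) simp
    show "of_bool (?E (D \<circ> \<pi>) (Suc n)) = (of_bool (?E D (\<pi> (Suc n))) :: real)"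
      if "D \<in> space Samples" "\<pi> permutes {1..Suc n}" for D \<pi>
      using straddles_permute[of \<pi> "Suc n" "fc_score (D \<circ> \<pi>)" "fc_score D" "Suc n"] that fc_score_permute[OF that]
      by simp
  qed
  define N where
    "N D = (\<Sum>i=1..Suc n. \<Sum>j=1..Suc n. of_bool (\<bar>fc_score D i - fc_score D j\<bar> \<le> 2 * d) :: real)" for D
  have int_N: "integrable Samples N"
    unfolding N_def
    by (intro Bochner_Integration.integrable_sum S.of_bool_expectation(1) pred_close)
  have N_le: "S.expectation N \<le> m * (1 + real n * (instability d + \<kappa>))"
    unfolding N_def[abs_def] m_def by (rule expected_close_pairs[OF close d])
  have "m * S.prob {D \<in> space Samples. ?E D (Suc n)}
      = (\<Sum>i=1..Suc n. S.expectation (\<lambda>D. of_bool (?E D (Suc n))))"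
    unfolding m_def by (subst S.of_bool_expectation(2)[OF pred_straddles]) simp_all
  also have "\<dots> = (\<Sum>i=1..Suc n. S.expectation (\<lambda>D. of_bool (?E D i)))"
    by (intro sum.cong refl eq[symmetric])
  also have "\<dots> = S.expectation (\<lambda>D. \<Sum>i=1..Suc n. of_bool (?E D i))"
    using int by (intro Bochner_Integration.integral_sum[symmetric])
  also have "\<dots> \<le> S.expectation (\<lambda>D. 4 * m * \<epsilon> + 2 / (m * \<epsilon>) * N D)"
  proof (rule integral_mono)
    show "integrable Samples (\<lambda>D. \<Sum>i=1..Suc n. of_bool (?E D i) :: real)"
      using int by (intro Bochner_Integration.integrable_sum)
    show "integrable Samples (\<lambda>D. 4 * m * \<epsilon> + 2 / (m * \<epsilon>) * N D)"
      by (intro Bochner_Integration.integrable_add S.integrable_const integrable_mult_right int_N)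
    show "(\<Sum>i=1..Suc n. of_bool (?E D i)) \<le> 4 * m * \<epsilon> + 2 / (m * \<epsilon>) * N D" for D
      unfolding m_def N_def using \<epsilon> d by (intro sum_straddles_le) auto
  qed
  also have "\<dots> = 4 * m * \<epsilon> + 2 / (m * \<epsilon>) * S.expectation N"
    using Bochner_Integration.integral_add[OF S.integrable_const[of "4 * m * \<epsilon>"]
        integrable_mult_right[OF int_N, of "2 / (m * \<epsilon>)"]]
    by (simp only: integral_mult_right_zero S.prob_space
        Bochner_Integration.lebesgue_integral_const scaleR_one)
  also have "\<dots> \<le> 4 * m * \<epsilon> + 2 / (m * \<epsilon>) * (m * (1 + real n * (instability d + \<kappa>)))"
    using \<epsilon> m by (intro add_left_mono mult_left_mono N_le) simp
  also have "\<dots> = 4 * m * \<epsilon> + 2 / \<epsilon> * (1 + real n * (instability d + \<kappa>))"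
    using \<epsilon> m by (simp add: field_simps)
  also have "\<dots> \<le> 4 * m * \<epsilon> + 2 / \<epsilon> * (1 + m * (instability d + \<kappa>))"
  proof -
    have "0 \<le> \<kappa>"
      using order_trans[OF measure_nonneg close[of 1]] n_ge by simp
    moreover have "0 \<le> instability d" by (simp add: instability_def)
    ultimately show ?thesis
      using \<epsilon> by (intro add_left_mono mult_left_mono mult_right_mono) (auto simp: m_def)
  qed
  also have "\<dots> = m * (4 * \<epsilon> + 2 / \<epsilon> * (1 / m + instability d + \<kappa>))"
    using \<epsilon> m by (simp add: field_simps)
  finally show ?thesis
    using m unfolding m_def[symmetric] by (simp only: mult_le_cancel_left_pos)
qed

end

section \<open>Conditional densities and the expected length of a random set\<close>

text \<open>
  Disintegration: the defining identity on rectangles determines the joint law of \<open>V\<close> and \<open>X\<close>,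
  because rectangles are an intersection-stable generator.
\<close>

lemma regular_cond_distr_nn_integral:
  assumes "prob_space M" and rcd: "regular_cond_distr M S X N V K"
    and h: "h \<in> borel_measurable (N \<Otimes>\<^sub>M S)"
  shows "(\<integral>\<^sup>+\<omega>. h (V \<omega>, X \<omega>) \<partial>M) = (\<integral>\<^sup>+a. (\<integral>\<^sup>+x. h (a, x) \<partial>K a) \<partial>distr M N V)"
proof -
  interpret prob_space M by fact
  have X: "X \<in> M \<rightarrow>\<^sub>M S" and V: "V \<in> M \<rightarrow>\<^sub>M N" and K: "K \<in> N \<rightarrow>\<^sub>M prob_algebra S"
    and rect: "\<And>A B. A \<in> sets N \<Longrightarrow> B \<in> sets S \<Longrightarrow>
        emeasure M {\<omega> \<in> space M. V \<omega> \<in> A \<and> X \<omega> \<in> B}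
          = (\<integral>\<^sup>+ a. emeasure (K a) B * indicator A a \<partial>distr M N V)"
    using rcd by (auto simp: regular_cond_distr_def)
  have VX: "(\<lambda>\<omega>. (V \<omega>, X \<omega>)) \<in> M \<rightarrow>\<^sub>M N \<Otimes>\<^sub>M S"
    using V X by (rule measurable_Pair)
  have setsK: "sets (K a) = sets S" if "a \<in> space N" for a
    using measurable_space[OF K that] by (simp add: space_prob_algebra)
  define L where "L a = distr (K a) (N \<Otimes>\<^sub>M S) (Pair a)" for a
  have L: "L \<in> N \<rightarrow>\<^sub>M prob_algebra (N \<Otimes>\<^sub>M S)"
    unfolding L_def by (rule measurable_distr_prob_space2[OF K]) simp
  have L': "L \<in> distr M N V \<rightarrow>\<^sub>M subprob_algebra (N \<Otimes>\<^sub>M S)"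
    using measurable_prob_algebraD[OF L] by simp
  have ne: "space (distr M N V) \<noteq> {}"
    by (rule prob_space.not_empty[OF prob_space_distr[OF V]])
  have pair_K: "Pair a \<in> K a \<rightarrow>\<^sub>M N \<Otimes>\<^sub>M S" if "a \<in> space N" for a
    unfolding measurable_cong_sets[OF setsK[OF that] refl] by (rule measurable_Pair1'[OF that])
  \<comment> \<open>\<open>L a\<close> is the law of \<open>(a, X)\<close> given \<open>V = a\<close>.\<close>
  have "distr M (N \<Otimes>\<^sub>M S) (\<lambda>\<omega>. (V \<omega>, X \<omega>)) = distr M N V \<bind> L"
  proof (rule measure_eqI_generator_eq[OF Int_stable_pair_measure_generator[of N S],
        where \<Omega> = "space N \<times> space S" and A = "\<lambda>_. space N \<times> space S"])
    show "sets (distr M N V \<bind> L) = sigma_sets (space N \<times> space S) {a \<times> b |a b. a \<in> sets N \<and> b \<in> sets S}"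
      using sets_bind[OF sets_kernel[OF L'] ne] by (simp add: sets_pair_measure)
    show "sets (distr M (N \<Otimes>\<^sub>M S) (\<lambda>\<omega>. (V \<omega>, X \<omega>)))
        = sigma_sets (space N \<times> space S) {a \<times> b |a b. a \<in> sets N \<and> b \<in> sets S}"
      by (simp add: sets_pair_measure)
    show "emeasure (distr M (N \<Otimes>\<^sub>M S) (\<lambda>\<omega>. (V \<omega>, X \<omega>))) (space N \<times> space S) \<noteq> \<infinity>" for i :: nat
      using prob_space.prob_space_distr[OF assms(1) VX]
      by (simp add: finite_measure.emeasure_finite prob_space.finite_measure)
    fix E assume "E \<in> {a \<times> b |a b. a \<in> sets N \<and> b \<in> sets S}"
    then obtain A B where E: "E = A \<times> B" and A: "A \<in> sets N" and B: "B \<in> sets S" by auto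
    have AB: "A \<times> B \<in> sets (N \<Otimes>\<^sub>M S)" using A B by simp
    have "emeasure (distr M (N \<Otimes>\<^sub>M S) (\<lambda>\<omega>. (V \<omega>, X \<omega>))) (A \<times> B)
        = emeasure M {\<omega> \<in> space M. V \<omega> \<in> A \<and> X \<omega> \<in> B}"
      unfolding emeasure_distr[OF VX AB] by (intro arg_cong[where f = "emeasure M"]) auto
    also have "\<dots> = (\<integral>\<^sup>+ a. emeasure (L a) (A \<times> B) \<partial>distr M N V)"
      unfolding rect[OF A B]
    proof (rule nn_integral_cong)
      fix a assume "a \<in> space (distr M N V)"
      then have a: "a \<in> space N" by simp
      have "emeasure (L a) (A \<times> B) = emeasure (K a) (Pair a -` (A \<times> B) \<inter> space (K a))"
        unfolding L_def by (rule emeasure_distr[OF pair_K[OF a] AB])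
      also have "Pair a -` (A \<times> B) \<inter> space (K a) = (if a \<in> A then B else {})"
        using sets.sets_into_space[OF B] sets_eq_imp_space_eq[OF setsK[OF a]] by auto
      finally show "emeasure (K a) B * indicator A a = emeasure (L a) (A \<times> B)"
        by simp
    qed
    also have "\<dots> = emeasure (distr M N V \<bind> L) (A \<times> B)"
      by (rule emeasure_bind[OF ne L' AB, symmetric])
    finally show "emeasure (distr M (N \<Otimes>\<^sub>M S) (\<lambda>\<omega>. (V \<omega>, X \<omega>))) E = emeasure (distr M N V \<bind> L) E"
      by (simp add: E)
  qed (use sets.space_closed[of N] sets.space_closed[of S] in auto)
  then have "(\<integral>\<^sup>+\<omega>. h (V \<omega>, X \<omega>) \<partial>M) = (\<integral>\<^sup>+ z. h z \<partial>(distr M N V \<bind> L))"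
    using nn_integral_distr[OF VX, unfolded measurable_distr_eq1, OF h] by simp
  also have "\<dots> = (\<integral>\<^sup>+ a. (\<integral>\<^sup>+ z. h z \<partial>L a) \<partial>distr M N V)"
    by (rule nn_integral_bind[OF h L'])
  also have "\<dots> = (\<integral>\<^sup>+a. (\<integral>\<^sup>+x. h (a, x) \<partial>K a) \<partial>distr M N V)"
    by (intro nn_integral_cong) (simp add: L_def nn_integral_distr[OF pair_K, unfolded measurable_distr_eq1, OF _ h])
  finally show ?thesis .
qed

lemma cond_density_lower_bound:
  assumes M: "prob_space M" and dens: "has_cond_density M X N V f"
    and lower: "AE a in distr M N V. \<forall>y\<in>A. ennreal f0 \<le> f a y"
    and A: "A \<in> sets borel" and h: "h \<in> borel_measurable (N \<Otimes>\<^sub>M borel)"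
  shows "ennreal f0 * (\<integral>\<^sup>+a. (\<integral>\<^sup>+y. h (a, y) * indicator A y \<partial>lborel) \<partial>distr M N V)
    \<le> (\<integral>\<^sup>+\<omega>. h (V \<omega>, X \<omega>) \<partial>M)"
proof -
  obtain K where K: "regular_cond_distr M borel X N V K"
    and f: "AE a in distr M N V. f a \<in> borel_measurable borel \<and> K a = density lborel (f a)"
    using dens by (auto simp: has_cond_density_def)
  have hA: "(\<lambda>(a, y). h (a, y) * indicator A y) \<in> borel_measurable (N \<Otimes>\<^sub>M lborel)"
    using A h by measurable
  have h_a: "(\<lambda>y. h (a, y)) \<in> borel_measurable borel" if "a \<in> space N" for a
    using measurable_compose[OF measurable_Pair1'[OF that] h] .
  have "(\<lambda>a. \<integral>\<^sup>+y. h (a, y) * indicator A y \<partial>lborel) \<in> borel_measurable (distr M N V)"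
    using lborel.borel_measurable_nn_integral[OF hA] by simp
  then have "ennreal f0 * (\<integral>\<^sup>+a. (\<integral>\<^sup>+y. h (a, y) * indicator A y \<partial>lborel) \<partial>distr M N V)
      = (\<integral>\<^sup>+a. ennreal f0 * (\<integral>\<^sup>+y. h (a, y) * indicator A y \<partial>lborel) \<partial>distr M N V)"
    by (rule nn_integral_cmult[symmetric])
  also have "\<dots> \<le> (\<integral>\<^sup>+a. (\<integral>\<^sup>+x. h (a, x) \<partial>K a) \<partial>distr M N V)"
  proof (rule nn_integral_mono_AE)
    show "AE a in distr M N V. ennreal f0 * (\<integral>\<^sup>+y. h (a, y) * indicator A y \<partial>lborel)
        \<le> (\<integral>\<^sup>+x. h (a, x) \<partial>K a)"
      using f lower AE_space
    proof eventually_elim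
      case (elim a)
      then have a: "a \<in> space N" by simp
      have "ennreal f0 * (\<integral>\<^sup>+y. h (a, y) * indicator A y \<partial>lborel)
          = (\<integral>\<^sup>+y. ennreal f0 * (h (a, y) * indicator A y) \<partial>lborel)"
        using h_a[OF a] A by (intro nn_integral_cmult[symmetric]) simp
      also have "\<dots> \<le> (\<integral>\<^sup>+y. f a y * h (a, y) \<partial>lborel)"
        using elim(2) by (intro nn_integral_mono) (auto simp: indicator_def intro: mult_right_mono)
      also have "\<dots> = (\<integral>\<^sup>+x. h (a, x) \<partial>K a)"
        using elim(1) h_a[OF a] by (simp add: nn_integral_density)
      finally show ?case .
    qed
  qed
  also have "\<dots> = (\<integral>\<^sup>+\<omega>. h (V \<omega>, X \<omega>) \<partial>M)"
    by (rule regular_cond_distr_nn_integral[OF M K, symmetric]) (use h in simp)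
  finally show ?thesis .
qed

lemma sets_z_space_subset:
  assumes Y: "Y \<in> sets borel"
  shows "sets (z_space Y p) \<subseteq> sets (borel \<Otimes>\<^sub>M x_space p)"
proof -
  have "a \<times> b \<in> sets (borel \<Otimes>\<^sub>M x_space p)"
    if "a \<in> sets (restrict_space borel Y)" "b \<in> sets (x_space p)" for a b
    using that Y by (auto simp: sets_restrict_space_iff)
  moreover have "space (restrict_space borel Y) \<times> space (x_space p) \<in> sets (borel \<Otimes>\<^sub>M x_space p)"
    using Y by (auto simp: space_restrict_space)
  ultimately show ?thesis
    unfolding z_space_def sets_pair_measure[of "restrict_space borel Y"]
    by (intro sets.sigma_sets_subset') auto
qed

text \<open>
  Integrating the new response against Lebesgue measure instead of its conditional law costs at
  most a factor \<open>1 / f0\<close>.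
\<close>

lemma response_length_le:
  assumes M: "prob_space M" and Y: "Y \<in> sets borel"
    and sets_P: "sets P = sets (z_space Y p)"
    and Z: "Z \<in> M \<rightarrow>\<^sub>M P" and law: "distr M P Z = P"
    and f0: "f0 > 0"
    and dens: "has_cond_density M (\<lambda>\<omega>. fst (Z \<omega>)) (x_space p) (\<lambda>\<omega>. snd (Z \<omega>)) f"
    and lower: "AE x in distr M (x_space p) (\<lambda>\<omega>. snd (Z \<omega>)). \<forall>y\<in>Y. ennreal f0 \<le> f x y"
    and B: "B \<in> sets P"
  shows "(\<integral>\<^sup>+z. emeasure lborel {y\<in>Y. (y, snd z) \<in> B} \<partial>P) \<le> ennreal (1 / f0) * emeasure P B"
proof -
  define V where "V \<omega> = snd (Z \<omega>)" for \<omega>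
  define h :: "_ \<Rightarrow> ennreal" where "h = (\<lambda>(x, y). indicator B (y, x))"
  have B': "B \<in> sets (borel \<Otimes>\<^sub>M x_space p)"
    using B sets_z_space_subset[OF Y] sets_P by blast
  have h: "h \<in> borel_measurable (x_space p \<Otimes>\<^sub>M borel)"
    unfolding h_def case_prod_unfold
    by (rule measurable_compose[OF _ borel_measurable_indicator[OF B']]) measurable
  define G where "G x = emeasure lborel {y\<in>Y. (y, x) \<in> B}" for x
  have B_x: "{y. (y, x) \<in> B} \<in> sets borel" if "x \<in> space (x_space p)" for x
    using measurable_sets[OF measurable_Pair2'[OF that] B'] by (simp add: vimage_def)
  have G_eq: "G x = (\<integral>\<^sup>+y. h (x, y) * indicator Y y \<partial>lborel)" if "x \<in> space (x_space p)" for x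
  proof -
    have S: "{y\<in>Y. (y, x) \<in> B} \<in> sets lborel"
      using sets.Int[OF Y B_x[OF that]] by (simp add: Int_def)
    have "G x = (\<integral>\<^sup>+y. indicator {y\<in>Y. (y, x) \<in> B} y \<partial>lborel)"
      unfolding G_def using S by simp
    also have "\<dots> = (\<integral>\<^sup>+y. h (x, y) * indicator Y y \<partial>lborel)"
      by (intro nn_integral_cong) (auto simp: h_def indicator_def)
    finally show ?thesis .
  qed
  have hY: "(\<lambda>(a, y). h (a, y) * indicator Y y) \<in> borel_measurable (x_space p \<Otimes>\<^sub>M lborel)"
    using Y h by measurable
  have G: "G \<in> borel_measurable (x_space p)"
    using lborel.borel_measurable_nn_integral[OF hY] by (subst measurable_cong[OF G_eq])
  have snd_P: "snd \<in> P \<rightarrow>\<^sub>M x_space p"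
    using measurable_snd[of "restrict_space borel Y" "x_space p"]
    by (simp add: measurable_cong_sets[OF sets_P refl] z_space_def)
  have V: "V \<in> M \<rightarrow>\<^sub>M x_space p"
    unfolding V_def using Z snd_P by (rule measurable_compose)
  have "ennreal f0 * (\<integral>\<^sup>+z. G (snd z) \<partial>P) = ennreal f0 * (\<integral>\<^sup>+\<omega>. G (V \<omega>) \<partial>M)"
    using nn_integral_distr[OF Z, unfolded measurable_distr_eq1, OF measurable_compose[OF snd_P G]] law by (simp add: V_def)
  also have "\<dots> = ennreal f0 * (\<integral>\<^sup>+x. G x \<partial>distr M (x_space p) V)"
    by (simp add: nn_integral_distr[OF V, unfolded measurable_distr_eq1, OF G])
  also have "\<dots> = ennreal f0 * (\<integral>\<^sup>+x. (\<integral>\<^sup>+y. h (x, y) * indicator Y y \<partial>lborel) \<partial>distr M (x_space p) V)"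
    by (intro arg_cong[where f = "(*) _"] nn_integral_cong) (simp add: G_eq)
  also have "\<dots> \<le> (\<integral>\<^sup>+\<omega>. h (V \<omega>, fst (Z \<omega>)) \<partial>M)"
    using cond_density_lower_bound[OF M dens lower Y h] by (simp add: V_def[abs_def])
  also have "\<dots> = (\<integral>\<^sup>+\<omega>. indicator B (Z \<omega>) \<partial>M)"
    by (simp add: h_def V_def)
  also have "\<dots> = (\<integral>\<^sup>+z. indicator B z \<partial>distr M P Z)"
    using B by (intro nn_integral_distr[OF Z, symmetric]) simp
  also have "\<dots> = emeasure P B"
    unfolding law using B by simp
  finally have *: "ennreal f0 * (\<integral>\<^sup>+z. G (snd z) \<partial>P) \<le> emeasure P B" .
  have "ennreal (1 / f0) * ennreal f0 = 1"
    using f0 by (simp add: ennreal_mult[symmetric])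
  then have "(\<integral>\<^sup>+z. G (snd z) \<partial>P) = ennreal (1 / f0) * (ennreal f0 * (\<integral>\<^sup>+z. G (snd z) \<partial>P))"
    by (simp add: mult.assoc[symmetric])
  also have "\<dots> \<le> ennreal (1 / f0) * emeasure P B"
    using * by (intro mult_left_mono) auto
  finally show ?thesis by (simp add: G_def)
qed

context sample_scores
begin

lemma nn_integral_Samples:
  assumes "g \<in> borel_measurable Samples"
  shows "(\<integral>\<^sup>+D. g D \<partial>Samples) = (\<integral>\<^sup>+T. (\<integral>\<^sup>+z. g (T(Suc n := z)) \<partial>P) \<partial>PiM {1..n} (\<lambda>_. P))"
proof -
  interpret product_sigma_finite "\<lambda>_::nat. P"
    by unfold_locales
  have eq: "{1..Suc n} = insert (Suc n) {1..n}" by auto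
  show ?thesis
    using product_nn_integral_insert[of "{1..n}" "Suc n" g] assms unfolding eq by simp
qed

text \<open>
  The bound for a single point extends to the sample, where only the response of the last point is
  replaced, by integrating over the other points.
\<close>

lemma expected_length_le:
  assumes Y: "Y \<in> sets borel" and sets_P: "sets P = sets (z_space Y p)"
    and slice: "\<And>B. B \<in> sets P \<Longrightarrow>
      (\<integral>\<^sup>+z. emeasure lborel {y\<in>Y. (y, snd z) \<in> B} \<partial>P) \<le> ennreal k * emeasure P B"
    and B: "B \<in> sets Samples"
  shows "(\<lambda>D. emeasure lborel {y\<in>Y. D(Suc n := (y, snd (D (Suc n)))) \<in> B}) \<in> borel_measurable Samples"
    and "(\<integral>\<^sup>+D. emeasure lborel {y\<in>Y. D(Suc n := (y, snd (D (Suc n)))) \<in> B} \<partial>Samples)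
      \<le> ennreal k * emeasure Samples B"
    and "\<And>D. D \<in> space Samples \<Longrightarrow> {y\<in>Y. D(Suc n := (y, snd (D (Suc n)))) \<in> B} \<in> sets lborel"
proof -
  let ?R = "restrict_space lborel Y"
  let ?upd = "\<lambda>(D, y). D(Suc n := (y, snd (D (Suc n))))"
  let ?g = "\<lambda>D. emeasure lborel {y\<in>Y. D(Suc n := (y, snd (D (Suc n)))) \<in> B}"
  interpret R: sigma_finite_measure ?R
    using Y by (intro sigma_finite_measure_restrict_space lborel.sigma_finite_measure_axioms) simp
  have spP: "space P = Y \<times> space (x_space p)"
    using sets_eq_imp_space_eq[OF sets_P]
    by (simp add: z_space_def space_pair_measure space_restrict_space)
  have sets_R: "sets ?R = sets (restrict_space borel Y)"
    by (rule sets_restrict_space_cong) simp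
  have snd_P: "snd \<in> P \<rightarrow>\<^sub>M x_space p"
    using measurable_snd[of "restrict_space borel Y" "x_space p"]
    by (simp add: measurable_cong_sets[OF sets_P refl] z_space_def)
  have comp: "(\<lambda>D. D (Suc n)) \<in> Samples \<rightarrow>\<^sub>M P"
    by (rule measurable_component_singleton) simp
  have "(\<lambda>w. (snd w, snd (fst w (Suc n)))) \<in> Samples \<Otimes>\<^sub>M ?R \<rightarrow>\<^sub>M restrict_space borel Y \<Otimes>\<^sub>M x_space p"
  proof (rule measurable_Pair)
    show "(\<lambda>w. snd w) \<in> Samples \<Otimes>\<^sub>M ?R \<rightarrow>\<^sub>M restrict_space borel Y"
      using measurable_snd[of Samples ?R] measurable_cong_sets[OF refl sets_R] by auto
    show "(\<lambda>w. snd (fst w (Suc n))) \<in> Samples \<Otimes>\<^sub>M ?R \<rightarrow>\<^sub>M x_space p"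
      by (rule measurable_compose[OF measurable_compose[OF measurable_fst comp] snd_P])
  qed
  then have new: "(\<lambda>w. (snd w, snd (fst w (Suc n)))) \<in> Samples \<Otimes>\<^sub>M ?R \<rightarrow>\<^sub>M P"
    by (simp only: measurable_cong_sets[OF refl sets_P] z_space_def)
  have upd: "?upd \<in> Samples \<Otimes>\<^sub>M ?R \<rightarrow>\<^sub>M Samples"
    unfolding case_prod_unfold
    by (rule measurable_fun_upd[where J = "{1..Suc n}", OF _ measurable_fst new]) auto
  define Q where "Q = ?upd -` B \<inter> space (Samples \<Otimes>\<^sub>M ?R)"
  have Q: "Q \<in> sets (Samples \<Otimes>\<^sub>M ?R)"
    unfolding Q_def using upd B by (rule measurable_sets)
  have Q_D: "Pair D -` Q = {y\<in>Y. D(Suc n := (y, snd (D (Suc n)))) \<in> B}" if "D \<in> space Samples" for D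
    using that by (auto simp: Q_def space_pair_measure space_restrict_space)
  have g_eq: "emeasure ?R (Pair D -` Q) = ?g D" if "D \<in> space Samples" for D
    unfolding Q_D[OF that] using Y by (intro emeasure_restrict_space) auto
  show "{y\<in>Y. D(Suc n := (y, snd (D (Suc n)))) \<in> B} \<in> sets lborel" if "D \<in> space Samples" for D
    using sets_Pair1[OF Q, of D] Y unfolding Q_D[OF that] by (simp add: sets_restrict_space_iff)
  show g: "?g \<in> borel_measurable Samples"
    using R.measurable_emeasure_Pair[OF Q] by (subst measurable_cong[OF g_eq[symmetric]])
  have "(\<integral>\<^sup>+D. ?g D \<partial>Samples)
      = (\<integral>\<^sup>+T. (\<integral>\<^sup>+z. ?g (T(Suc n := z)) \<partial>P) \<partial>PiM {1..n} (\<lambda>_. P))"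
    by (rule nn_integral_Samples[OF g])
  also have "\<dots> \<le> (\<integral>\<^sup>+T. ennreal k * (\<integral>\<^sup>+z. indicator B (T(Suc n := z)) \<partial>P) \<partial>PiM {1..n} (\<lambda>_. P))"
  proof (rule nn_integral_mono)
    fix T assume T: "T \<in> space (PiM {1..n} (\<lambda>_. P))"
    define B_T where "B_T = {z \<in> space P. T(Suc n := z) \<in> B}"
    have "(\<lambda>z. T(Suc n := z)) \<in> P \<rightarrow>\<^sub>M Samples"
      using T by (intro measurable_fun_upd[where J = "{1..n}"]) auto
    from measurable_sets[OF this B] have B_T: "B_T \<in> sets P"
      by (simp add: B_T_def vimage_def Int_def conj_commute)
    have "(\<integral>\<^sup>+z. ?g (T(Suc n := z)) \<partial>P) = (\<integral>\<^sup>+z. emeasure lborel {y\<in>Y. (y, snd z) \<in> B_T} \<partial>P)"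
      by (intro nn_integral_cong arg_cong[where f = "emeasure lborel"])
        (auto simp: B_T_def spP)
    also have "\<dots> \<le> ennreal k * emeasure P B_T"
      by (rule slice[OF B_T])
    also have "emeasure P B_T = (\<integral>\<^sup>+z. indicator B_T z \<partial>P)"
      using B_T by simp
    also have "\<dots> = (\<integral>\<^sup>+z. indicator B (T(Suc n := z)) \<partial>P)"
      by (intro nn_integral_cong) (auto simp: B_T_def indicator_def)
    finally show "(\<integral>\<^sup>+z. ?g (T(Suc n := z)) \<partial>P)
        \<le> ennreal k * (\<integral>\<^sup>+z. indicator B (T(Suc n := z)) \<partial>P)" .
  qed
  also have "\<dots> = (\<integral>\<^sup>+T. (\<integral>\<^sup>+z. ennreal k * indicator B (T(Suc n := z)) \<partial>P) \<partial>PiM {1..n} (\<lambda>_. P))"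
  proof (intro nn_integral_cong nn_integral_cmult[symmetric])
    fix T assume T: "T \<in> space (PiM {1..n} (\<lambda>_. P))"
    have "(\<lambda>z. T(Suc n := z)) \<in> P \<rightarrow>\<^sub>M Samples"
      using T by (intro measurable_fun_upd[where J = "{1..n}"]) auto
    then show "(\<lambda>z. indicator B (T(Suc n := z))) \<in> borel_measurable P"
      by (rule measurable_compose) (rule borel_measurable_indicator[OF B])
  qed
  also have "\<dots> = (\<integral>\<^sup>+D. ennreal k * indicator B D \<partial>Samples)"
    using B by (intro nn_integral_Samples[symmetric]) simp
  also have "\<dots> = ennreal k * emeasure Samples B"
    using B by (rule nn_integral_cmult_indicator)
  finally show "(\<integral>\<^sup>+D. ?g D \<partial>Samples) \<le> ennreal k * emeasure Samples B" .
qed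

end

section \<open>Prediction sets in terms of leave-one-out scores\<close>

lemma F_hat_eq_emp_cdf:
  assumes T: "T = restrict D {1..n}" and new: "D (Suc n) = (y, x)"
  shows "F_hat C n T x y = emp_cdf (Suc n) (loo_score (C n n) (Suc n) D)"
proof
  fix s
  have last: "C n n (y, x) T = loo_score (C n n) (Suc n) D (Suc n)"
    using new by (simp add: T loo_score_def drop_entry_def restrict_def fun_eq_iff cong: if_cong)
  have i: "C n n (T i) (drop_entry (n + 1) i (T(n + 1 := (y, x)))) = loo_score (C n n) (Suc n) D i"
    if "i \<in> {1..n}" for i
  proof -
    have "drop_entry (n + 1) i (T(n + 1 := (y, x))) = drop_entry (Suc n) i D"
      using that new by (auto simp: T drop_entry_def restrict_def fun_eq_iff)
    then show ?thesis using that by (simp add: T loo_score_def)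
  qed
  have "(\<Sum>i=1..n. of_bool (C n n (T i) (drop_entry (n + 1) i (T(n + 1 := (y, x)))) \<le> s) :: real)
      = (\<Sum>i=1..n. of_bool (loo_score (C n n) (Suc n) D i \<le> s))"
    by (intro sum.cong refl) (simp only: i)
  then show "F_hat C n T x y s = emp_cdf (Suc n) (loo_score (C n n) (Suc n) D) s"
    unfolding F_hat_def emp_cdf_def last by (simp add: add_divide_distrib)
qed

lemma G_hat_eq_emp_cdf:
  assumes T: "T = restrict D {1..n}"
  shows "G_hat C n T = emp_cdf n (loo_score (C n (n - 1)) n D)"
proof
  fix s
  have i: "C n (n - 1) (T i) (drop_entry n i T) = loo_score (C n (n - 1)) n D i"
    if "i \<in> {1..n}" for i
  proof -
    have "drop_entry n i T = drop_entry n i D"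
      using that by (auto simp: T drop_entry_def restrict_def fun_eq_iff)
    then show ?thesis using that by (simp add: T loo_score_def)
  qed
  have "(\<Sum>i=1..n. of_bool (C n (n - 1) (T i) (drop_entry n i T) \<le> s) :: real)
      = (\<Sum>i=1..n. of_bool (loo_score (C n (n - 1)) n D i \<le> s))"
    by (intro sum.cong refl) (simp only: i)
  then show "G_hat C n T s = emp_cdf n (loo_score (C n (n - 1)) n D) s"
    unfolding G_hat_def emp_cdf_def by simp
qed

text \<open>
  The training sample together with the new point, as an extensional tuple on \<open>{1..Suc n}\<close>.
\<close>

definition sample :: "(nat \<Rightarrow> nat \<Rightarrow> 'w \<Rightarrow> point) \<Rightarrow> nat \<Rightarrow> 'w \<Rightarrow> nat \<Rightarrow> point" where
  "sample t n \<omega> = (\<lambda>i\<in>{1..Suc n}. t n i \<omega>)"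

text \<open>
  The sample in which the response of the new point is replaced by \<open>y\<close>.
\<close>

definition new_response :: "nat \<Rightarrow> (nat \<Rightarrow> point) \<Rightarrow> real \<Rightarrow> nat \<Rightarrow> point" where
  "new_response n D y = D(Suc n := (y, snd (D (Suc n))))"

lemma train_eq_restrict:
  "train t n \<omega> = restrict (new_response n (sample t n \<omega>) y) {1..n}"
  "train t n \<omega> = drop_entry (Suc n) (Suc n) (sample t n \<omega>)"
  by (auto simp: train_def sample_def new_response_def drop_entry_def restrict_def fun_eq_iff)

text \<open>
  Membership of \<open>y\<close> in the prediction sets depends only on the leave-one-out scores of the sample with
  new response \<open>y\<close>. The shortcut scores \<open>w\<close> do not involve the new point and hence not \<open>y\<close>.
\<close>

lemma PS_iff:
  fixes t :: "nat \<Rightarrow> nat \<Rightarrow> 'w \<Rightarrow> point" and C :: "nat \<Rightarrow> nat \<Rightarrow> score" and n :: nat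
  defines "v \<equiv> \<lambda>\<omega> y. loo_score (C n n) (Suc n) (new_response n (sample t n \<omega>) y)"
    and "w \<equiv> \<lambda>\<omega> y. loo_score (C n (n - 1)) n (new_response n (sample t n \<omega>) y)"
  shows "y \<in> PS_fc Y C t n \<alpha> \<delta> \<omega> \<longleftrightarrow> y \<in> Y n \<and>
      ereal (v \<omega> y (Suc n)) \<le> quantile (emp_cdf (Suc n) (v \<omega> y)) (1 - \<alpha>) + ereal \<delta>"
    and "y \<in> PS_sc Y C t n \<alpha> \<delta> \<omega> \<longleftrightarrow> y \<in> Y n \<and>
      ereal (v \<omega> y (Suc n)) \<le> quantile (emp_cdf n (w \<omega> y)) (1 - \<alpha>) + ereal \<delta>"
proof -
  let ?D = "new_response n (sample t n \<omega>) y"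
  let ?x = "snd (t n (Suc n) \<omega>)"
  have last: "?D (Suc n) = (y, ?x)"
    by (simp add: new_response_def sample_def)
  have "drop_entry (Suc n) (Suc n) ?D = train t n \<omega>"
    by (auto simp: train_def sample_def new_response_def drop_entry_def restrict_def fun_eq_iff)
  then have c: "C n n (y, ?x) (train t n \<omega>) = v \<omega> y (Suc n)"
    using last by (simp add: v_def loo_score_def)
  show "y \<in> PS_fc Y C t n \<alpha> \<delta> \<omega> \<longleftrightarrow> y \<in> Y n \<and>
      ereal (v \<omega> y (Suc n)) \<le> quantile (emp_cdf (Suc n) (v \<omega> y)) (1 - \<alpha>) + ereal \<delta>"
    using F_hat_eq_emp_cdf[where C = C, OF train_eq_restrict(1)[of t n \<omega> y] last]
    by (simp add: PS_fc_def Let_def c) (simp add: v_def)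
  show "y \<in> PS_sc Y C t n \<alpha> \<delta> \<omega> \<longleftrightarrow> y \<in> Y n \<and>
      ereal (v \<omega> y (Suc n)) \<le> quantile (emp_cdf n (w \<omega> y)) (1 - \<alpha>) + ereal \<delta>"
    using G_hat_eq_emp_cdf[where C = C, OF train_eq_restrict(1)[of t n \<omega> y]]
    by (simp add: PS_sc_def Let_def c) (simp add: w_def)
qed

text \<open>
  Both inclusions follow from \<open>emp_cdf_perturb\<close>. No quantile has to be finite: \<open>s\<close> exceeding the
  \<open>a\<close>-quantile means that the level \<open>a\<close> is reached at some point below \<open>s\<close>.
\<close>

lemma prediction_inclusion:
  fixes v w :: "nat \<Rightarrow> real"
  assumes n: "n \<ge> 1" "1 / real n \<le> \<epsilon> / 2"
    and bad: "(\<Sum>i=1..n. of_bool (\<bar>v i - w i\<bar> > \<delta>2 - \<delta>1)) \<le> real n * \<epsilon> / 2"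
  shows "ereal s \<le> quantile (emp_cdf (Suc n) v) (1 - \<alpha>) + ereal \<delta>1 \<Longrightarrow>
      ereal s \<le> quantile (emp_cdf n w) (1 - (\<alpha> - \<epsilon>)) + ereal \<delta>2"
    and "ereal s \<le> quantile (emp_cdf n w) (1 - (\<alpha> + \<epsilon>)) + ereal \<delta>1 \<Longrightarrow>
      ereal s \<le> quantile (emp_cdf (Suc n) v) (1 - \<alpha>) + ereal \<delta>2"
proof -
  note perturb = emp_cdf_perturb[OF n bad]
  show "ereal s \<le> quantile (emp_cdf n w) (1 - (\<alpha> - \<epsilon>)) + ereal \<delta>2"
    if "ereal s \<le> quantile (emp_cdf (Suc n) v) (1 - \<alpha>) + ereal \<delta>1"
  proof (rule ccontr)
    assume "\<not> ?thesis"
    then obtain r where r: "r < s - \<delta>2" "1 - (\<alpha> - \<epsilon>) \<le> emp_cdf n w r"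
      by (rule ge_of_not_le_quantile)
    have "emp_cdf (Suc n) v (r + (\<delta>2 - \<delta>1)) < 1 - \<alpha>"
      using r(1) by (intro less_of_le_quantile[OF that]) simp
    with perturb(1)[of r] r(2) show False by linarith
  qed
  show "ereal s \<le> quantile (emp_cdf (Suc n) v) (1 - \<alpha>) + ereal \<delta>2"
    if "ereal s \<le> quantile (emp_cdf n w) (1 - (\<alpha> + \<epsilon>)) + ereal \<delta>1"
  proof (rule ccontr)
    assume "\<not> ?thesis"
    then obtain r where r: "r < s - \<delta>2" "1 - \<alpha> \<le> emp_cdf (Suc n) v r"
      by (rule ge_of_not_le_quantile)
    have "emp_cdf n w (r + (\<delta>2 - \<delta>1)) < 1 - (\<alpha> + \<epsilon>)"
      using r(1) by (intro less_of_le_quantile[OF that]) simp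
    with perturb(2)[of r] r(2) show False by linarith
  qed
qed

lemma sym_diff_imp_straddles:
  fixes v w :: "nat \<Rightarrow> real"
  assumes n: "n \<ge> 1" "1 / real n \<le> \<epsilon> / 2" and d: "d > 0"
    and bad: "(\<Sum>i=1..n. of_bool (\<bar>v i - w i\<bar> > d)) \<le> real n * \<epsilon> / 2"
    and differ: "(ereal (v (Suc n)) \<le> quantile (emp_cdf (Suc n) v) a + ereal 0)
      \<noteq> (ereal (v (Suc n)) \<le> quantile (emp_cdf n w) a + ereal 0)"
  shows "straddles (Suc n) v a \<epsilon> (2 * d) (Suc n)"
proof -
  let ?s = "v (Suc n)"
  note perturb = emp_cdf_perturb[OF n bad]
  have \<epsilon>: "0 \<le> \<epsilon>"
    using order_trans[of 0 "1 / real n" "\<epsilon> / 2"] n by simp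
  show ?thesis
  proof (cases "ereal ?s \<le> quantile (emp_cdf (Suc n) v) a + ereal 0")
    case True
    with differ have "\<not> ereal ?s \<le> quantile (emp_cdf n w) a + ereal 0" by blast
    then obtain r where r: "r < ?s - 0" "a \<le> emp_cdf n w r"
      by (rule ge_of_not_le_quantile)
    have "a - \<epsilon> \<le> emp_cdf (Suc n) v (r + d)"
      using perturb(1)[of r] r(2) by linarith
    also have "\<dots> \<le> emp_cdf (Suc n) v (?s + 2 * d)"
      using r(1) d by (intro emp_cdf_mono) simp
    finally show ?thesis
      using less_of_le_quantile[OF True, of "?s - 2 * d"] d \<epsilon> by (simp add: straddles_def)
  next
    case False
    then obtain r where r: "r < ?s - 0" "a \<le> emp_cdf (Suc n) v r"
      by (rule ge_of_not_le_quantile)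
    have "emp_cdf (Suc n) v r \<le> emp_cdf (Suc n) v (?s + 2 * d)"
      using r(1) d by (intro emp_cdf_mono) simp
    moreover have "emp_cdf n w (?s - d) < a"
    proof -
      have "ereal ?s \<le> quantile (emp_cdf n w) a + ereal 0"
        using differ False by blast
      from less_of_le_quantile[OF this, of "?s - d"] d show ?thesis by simp
    qed
    ultimately show ?thesis
      using perturb(2)[of "?s - 2 * d"] r(2) \<epsilon> by (simp add: straddles_def)
  qed
qed

section \<open>Expected lengths in the conformal model\<close>

lemma ennreal_tendsto_0I:
  fixes f :: "nat \<Rightarrow> ennreal"
  assumes "\<And>e. e > 0 \<Longrightarrow> eventually (\<lambda>n. f n \<le> ennreal e) sequentially"
  shows "f \<longlonglongrightarrow> 0"
proof (rule order_tendstoI)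
  fix a :: ennreal assume "0 < a"
  then obtain b where b: "0 < b" "b < a"
    using dense by blast
  then have "b < top" using top.not_eq_extremum order.strict_trans2 by fastforce
  then obtain e where e: "b = ennreal e" "0 \<le> e"
    by (cases b) auto
  with b have "e > 0" by auto
  from assms[OF this] show "eventually (\<lambda>n. f n < a) sequentially"
    by eventually_elim (use b e in auto)
next
  show "eventually (\<lambda>n. a < f n) sequentially" if "a < 0" for a
    using that by simp
qed

text \<open>
  The setting of the theorem for all sample sizes.
\<close>

locale conformal_model =
  fixes Y :: "nat \<Rightarrow> real set" and p :: "nat \<Rightarrow> nat" and P :: "nat \<Rightarrow> point measure"
    and M :: "nat \<Rightarrow> 'w measure" and t :: "nat \<Rightarrow> nat \<Rightarrow> 'w \<Rightarrow> point"
    and C :: "nat \<Rightarrow> nat \<Rightarrow> score" and f0 :: real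
  assumes interval: "\<And>n. n \<ge> 1 \<Longrightarrow> is_interval (Y n)"
    and prob_P: "\<And>n. n \<ge> 1 \<Longrightarrow> prob_space (P n)"
    and sets_P: "\<And>n. n \<ge> 1 \<Longrightarrow> sets (P n) = sets (z_space (Y n) (p n))"
    and prob_M: "\<And>n. n \<ge> 1 \<Longrightarrow> prob_space (M n)"
    and indep: "\<And>n. n \<ge> 1 \<Longrightarrow> prob_space.indep_vars (M n) (\<lambda>_. P n) (t n) {1..n + 1}"
    and ident: "\<And>n i. n \<ge> 1 \<Longrightarrow> i \<in> {1..n + 1} \<Longrightarrow> distr (M n) (P n) (t n i) = P n"
    and scores: "conformity_scores Y p C"
    and stable: "stable_scores M t C"
    and f0_pos: "f0 > 0"
    and cond_density: "\<And>n. n \<ge> 1 \<Longrightarrow>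
      \<exists>f. has_cond_density (M n) (\<lambda>\<omega>. fst (t n 1 \<omega>)) (x_space (p n)) (\<lambda>\<omega>. snd (t n 1 \<omega>)) f \<and>
          (AE x in distr (M n) (x_space (p n)) (\<lambda>\<omega>. snd (t n 1 \<omega>)).
             \<forall>y\<in>Y n. f x y \<ge> ennreal f0)"
begin

lemma sets_tuples:
  "n \<ge> 1 \<Longrightarrow> sets (tuple_space (Y n) (p n) m) = sets (PiM {1..m} (\<lambda>_. P n))"
  unfolding tuple_space_def by (intro sets_PiM_cong refl) (simp add: sets_P)

lemma score_measurable:
  assumes n: "n \<ge> 1" and m: "m \<ge> 1"
  shows "(\<lambda>(z, T). C n m z T) \<in> borel_measurable (P n \<Otimes>\<^sub>M PiM {1..m} (\<lambda>_. P n))"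
proof -
  have sets: "sets (P n \<Otimes>\<^sub>M PiM {1..m} (\<lambda>_. P n))
      = sets (z_space (Y n) (p n) \<Otimes>\<^sub>M tuple_space (Y n) (p n) m)"
    using n by (intro sets_pair_measure_cong sets_P sets_tuples[symmetric])
  have "(\<lambda>(z, T). C n m z T)
      \<in> borel_measurable (z_space (Y n) (p n) \<Otimes>\<^sub>M tuple_space (Y n) (p n) m)"
    using scores n m by (auto simp: conformity_scores_def)
  then show ?thesis
    unfolding measurable_cong_sets[OF sets refl] .
qed

lemma sample_scores:
  assumes n: "n \<ge> 2"
  shows "sample_scores (P n) n (C n n) (C n (n - 1))"
proof -
  interpret P: prob_space "P n" using n by (intro prob_P) simp
  have n1: "n \<ge> 1" "n - 1 \<ge> 1" using n by auto
  show ?thesis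
  proof
    show "2 \<le> n" by fact
    show "(\<lambda>(z, T). C n n z T) \<in> borel_measurable (P n \<Otimes>\<^sub>M PiM {1..n} (\<lambda>_. P n))"
      by (rule score_measurable[OF n1(1) n1(1)])
    show "(\<lambda>(z, T). C n (n - 1) z T) \<in> borel_measurable (P n \<Otimes>\<^sub>M PiM {1..n - 1} (\<lambda>_. P n))"
      by (rule score_measurable[OF n1(1) n1(2)])
    show "C n n z (T \<circ> \<sigma>) = C n n z T"
      if "z \<in> space (P n)" "T \<in> space (PiM {1..n} (\<lambda>_. P n))" "\<sigma> permutes {1..n}" for z T \<sigma>
      using scores n1(1) that sets_eq_imp_space_eq[OF sets_P[OF n1(1)]]
        sets_eq_imp_space_eq[OF sets_tuples[OF n1(1), of n]]
      by (simp add: conformity_scores_def)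
  qed
qed

lemma response_borel: "n \<ge> 1 \<Longrightarrow> Y n \<in> sets borel"
  by (intro real_interval_borel_measurable interval)

lemma data_measurable:
  assumes "n \<ge> 1" "i \<in> {1..Suc n}"
  shows "t n i \<in> M n \<rightarrow>\<^sub>M P n"
proof -
  interpret prob_space "M n" using assms by (intro prob_M)
  show ?thesis using indep[of n] assms unfolding indep_vars_def by auto
qed

lemma sample_distr:
  assumes n: "n \<ge> 1"
  shows "sample t n \<in> M n \<rightarrow>\<^sub>M PiM {1..Suc n} (\<lambda>_. P n)"
    and "distr (M n) (PiM {1..Suc n} (\<lambda>_. P n)) (sample t n) = PiM {1..Suc n} (\<lambda>_. P n)"
proof -
  interpret prob_space "M n" using n by (rule prob_M)
  show "sample t n \<in> M n \<rightarrow>\<^sub>M PiM {1..Suc n} (\<lambda>_. P n)"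
    unfolding sample_def[abs_def] by (intro measurable_restrict data_measurable n)
  have "distr (M n) (PiM {1..Suc n} (\<lambda>_. P n)) (sample t n)
      = PiM {1..Suc n} (\<lambda>i. distr (M n) (P n) (t n i))"
    using iffD1[OF indep_vars_iff_distr_eq_PiM'[where I = "{1..Suc n}" and M' = "\<lambda>_. P n" and X = "t n"]]
      indep[OF n]
      data_measurable[OF n]
    by (simp add: sample_def[abs_def])
  also have "\<dots> = PiM {1..Suc n} (\<lambda>_. P n)"
    using ident[OF n] by (intro PiM_cong refl) simp
  finally show "distr (M n) (PiM {1..Suc n} (\<lambda>_. P n)) (sample t n) = PiM {1..Suc n} (\<lambda>_. P n)" .
qed

lemma prob_sample:
  assumes n: "n \<ge> 1" and Q: "{D \<in> space (PiM {1..Suc n} (\<lambda>_. P n)). Q D} \<in> sets (PiM {1..Suc n} (\<lambda>_. P n))"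
  shows "measure (PiM {1..Suc n} (\<lambda>_. P n)) {D \<in> space (PiM {1..Suc n} (\<lambda>_. P n)). Q D}
    = measure (M n) {\<omega> \<in> space (M n). Q (sample t n \<omega>)}"
proof -
  have "measure (distr (M n) (PiM {1..Suc n} (\<lambda>_. P n)) (sample t n)) {D \<in> space (PiM {1..Suc n} (\<lambda>_. P n)). Q D}
    = measure (M n) (sample t n -` {D \<in> space (PiM {1..Suc n} (\<lambda>_. P n)). Q D} \<inter> space (M n))"
    by (rule measure_distr[OF sample_distr(1)[OF n] Q])
  also have "sample t n -` {D \<in> space (PiM {1..Suc n} (\<lambda>_. P n)). Q D} \<inter> space (M n)
      = {\<omega> \<in> space (M n). Q (sample t n \<omega>)}"
    using measurable_space[OF sample_distr(1)[OF n]] by blast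
  finally show ?thesis unfolding sample_distr(2)[OF n] .
qed

abbreviation instab :: "nat \<Rightarrow> real \<Rightarrow> real" where
  "instab n d \<equiv> sample_scores.instability (P n) n (C n n) (C n (n - 1)) d"

lemma instab_tendsto:
  assumes d: "d > 0"
  shows "(\<lambda>n. instab n d) \<longlonglongrightarrow> 0"
proof -
  have eq: "instab n d = measure (M n) {\<omega> \<in> space (M n).
      \<bar>\<bar>C n n (t n (Suc n) \<omega>) (train t n \<omega>)
       - C n (n - 1) (t n (Suc n) \<omega>) (drop_entry n n (train t n \<omega>))\<bar>\<bar> > d}" if n: "n \<ge> 2" for n
  proof -
    interpret S: sample_scores "P n" n "C n n" "C n (n - 1)"
      using n by (rule sample_scores)
    have n1: "n \<ge> 1" using n by simp
    have drop: "drop_entry n n (train t n \<omega>) = drop_entry n n (sample t n \<omega>)" for \<omega>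
      using n by (auto simp: train_def sample_def drop_entry_def restrict_def fun_eq_iff)
    have last: "sample t n \<omega> (Suc n) = t n (Suc n) \<omega>" for \<omega>
      by (simp add: sample_def)
    have "{D \<in> space S.Samples. \<bar>S.fc_score D (Suc n) - C n (n - 1) (D (Suc n)) (drop_entry n n D)\<bar> > d}
        \<in> sets S.Samples"
      using S.measurable_fc_score[of "Suc n"] S.measurable_sc_score_new by measurable
    from prob_sample[OF n1 this] show ?thesis
      by (simp only: S.instability_def S.fc_score_def loo_score_def last drop train_eq_restrict(2) abs_abs)
        (simp only: drop[unfolded train_eq_restrict(2)])
  qed
  have "(\<lambda>n. measure (M n) {\<omega> \<in> space (M n).
      \<bar>\<bar>C n n (t n (Suc n) \<omega>) (train t n \<omega>)
       - C n (n - 1) (t n (Suc n) \<omega>) (drop_entry n n (train t n \<omega>))\<bar>\<bar> > d}) \<longlonglongrightarrow> 0"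
    using stable d by (simp add: stable_scores_def tendsto_zero_in_prob_def)
  then show ?thesis
    by (rule Lim_transform_eventually[OF _ eventually_mono[OF eventually_ge_at_top[of 2] eq[symmetric]]])
qed

lemma length_le:
  assumes n: "n \<ge> 2" and Q: "Measurable.pred (PiM {1..Suc n} (\<lambda>_. P n)) Q"
    and A: "\<And>\<omega> y. y \<in> A \<omega> \<Longrightarrow> y \<in> Y n \<and> Q (new_response n (sample t n \<omega>) y)"
  shows "(\<integral>\<^sup>+\<omega>. emeasure lborel (A \<omega>) \<partial>M n)
    \<le> ennreal (1 / f0 * measure (PiM {1..Suc n} (\<lambda>_. P n)) {D \<in> space (PiM {1..Suc n} (\<lambda>_. P n)). Q D})"
proof -
  interpret S: sample_scores "P n" n "C n n" "C n (n - 1)"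
    using n by (rule sample_scores)
  have n1: "n \<ge> 1" using n by simp
  define B where "B = {D \<in> space S.Samples. Q D}"
  have B: "B \<in> sets S.Samples" using Q by (simp add: B_def pred_def)
  obtain f where dens: "has_cond_density (M n) (\<lambda>\<omega>. fst (t n 1 \<omega>)) (x_space (p n)) (\<lambda>\<omega>. snd (t n 1 \<omega>)) f"
    and lower: "AE x in distr (M n) (x_space (p n)) (\<lambda>\<omega>. snd (t n 1 \<omega>)). \<forall>y\<in>Y n. f x y \<ge> ennreal f0"
    using cond_density[OF n1] by blast
  have slice: "(\<integral>\<^sup>+z. emeasure lborel {y\<in>Y n. (y, snd z) \<in> B} \<partial>P n) \<le> ennreal (1 / f0) * emeasure (P n) B"
    if "B \<in> sets (P n)" for B
    by (rule response_length_le[OF prob_M[OF n1] response_borel[OF n1] sets_P[OF n1]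
        data_measurable[OF n1] ident[OF n1] f0_pos dens lower that]) auto
  have len1: "(\<lambda>D. emeasure lborel {y\<in>Y n. new_response n D y \<in> B}) \<in> borel_measurable S.Samples"
    unfolding new_response_def
    by (rule S.expected_length_le(1)[OF response_borel[OF n1] sets_P[OF n1] _ B]) (rule slice)
  have len2: "(\<integral>\<^sup>+D. emeasure lborel {y\<in>Y n. new_response n D y \<in> B} \<partial>S.Samples)
      \<le> ennreal (1 / f0) * emeasure S.Samples B"
    unfolding new_response_def
    by (rule S.expected_length_le(2)[OF response_borel[OF n1] sets_P[OF n1] _ B]) (rule slice)
  have len3: "{y\<in>Y n. new_response n D y \<in> B} \<in> sets lborel" if "D \<in> space S.Samples" for D
    unfolding new_response_def
    by (rule S.expected_length_le(3)[OF response_borel[OF n1] sets_P[OF n1] _ B that]) (rule slice)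
  have spP: "space (P n) = Y n \<times> space (x_space (p n))"
    using sets_eq_imp_space_eq[OF sets_P[OF n1]]
    by (simp add: z_space_def space_pair_measure space_restrict_space)
  have "(\<integral>\<^sup>+\<omega>. emeasure lborel (A \<omega>) \<partial>M n)
      \<le> (\<integral>\<^sup>+\<omega>. emeasure lborel {y\<in>Y n. new_response n (sample t n \<omega>) y \<in> B} \<partial>M n)"
  proof (rule nn_integral_mono)
    fix \<omega> assume \<omega>: "\<omega> \<in> space (M n)"
    have D: "sample t n \<omega> \<in> space S.Samples"
      using measurable_space[OF sample_distr(1)[OF n1] \<omega>] .
    have "new_response n (sample t n \<omega>) y \<in> space S.Samples" if "y \<in> Y n" for y
    proof -
      have "sample t n \<omega> (Suc n) \<in> space (P n)"
        using D by (auto simp: space_PiM PiE_def Pi_def)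
      then have "(y, snd (sample t n \<omega> (Suc n))) \<in> space (P n)"
        using that by (auto simp: spP)
      then show ?thesis
        using D by (auto simp: new_response_def space_PiM PiE_def Pi_def extensional_def)
    qed
    then show "emeasure lborel (A \<omega>) \<le> emeasure lborel {y\<in>Y n. new_response n (sample t n \<omega>) y \<in> B}"
      using A len3[OF D] by (intro emeasure_mono) (auto simp: B_def)
  qed
  also have "\<dots> = (\<integral>\<^sup>+D. emeasure lborel {y\<in>Y n. new_response n D y \<in> B} \<partial>distr (M n) S.Samples (sample t n))"
    by (rule nn_integral_distr[OF sample_distr(1)[OF n1], unfolded measurable_distr_eq1, OF len1, symmetric])
  also have "\<dots> \<le> ennreal (1 / f0) * emeasure S.Samples B"
    unfolding sample_distr(2)[OF n1] by (rule len2)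
  also have "\<dots> = ennreal (1 / f0 * S.S.prob B)"
    using f0_pos by (simp only: S.S.emeasure_eq_measure ennreal_mult[symmetric]) (simp add: ennreal_mult[symmetric])
  finally show ?thesis by (simp add: B_def)
qed

text \<open>
  Given the training sample, \<open>R\<^sub>i\<close> is a constant and the score of the new point has a density bounded by
  \<open>K\<close>, unless the exceptional event \<open>A\<close> occurs.
\<close>

lemma prob_close_le:
  assumes n: "n \<ge> 2" and i: "i \<in> {1..n}"
    and dens: "has_cond_density (M n) (test_score C t n) (tuple_space (Y n) (p n) n) (train t n) f"
    and A: "A \<in> sets (M n)" and K: "K \<ge> 0"
    and bound: "\<And>\<omega>. \<omega> \<in> space (M n) - A \<Longrightarrow> (SUP s. f (train t n \<omega>) s) \<le> ennreal K"
    and d: "d \<ge> 0"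
  shows "measure (PiM {1..Suc n} (\<lambda>_. P n)) {D \<in> space (PiM {1..Suc n} (\<lambda>_. P n)).
      \<bar>loo_score (C n n) (Suc n) D (Suc n) - loo_score (C n (n - 1)) n D i\<bar> \<le> d}
    \<le> measure (M n) A + 2 * K * d"
proof -
  interpret S: sample_scores "P n" n "C n n" "C n (n - 1)"
    using n by (rule sample_scores)
  have n1: "n \<ge> 1" using n by simp
  interpret M: prob_space "M n" using n1 by (rule prob_M)
  let ?N = "tuple_space (Y n) (p n) n"
  define r where "r T = loo_score (C n (n - 1)) n T i" for T
  have r: "r \<in> borel_measurable ?N"
    using S.measurable_sc_score[OF i subset_refl]
    by (simp only: r_def[abs_def] S.sc_score_def measurable_cong_sets[OF sets_tuples[OF n1] refl])
  have r_train: "loo_score (C n (n - 1)) n (sample t n \<omega>) i = r (train t n \<omega>)" for \<omega>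
  proof -
    have "drop_entry n i (sample t n \<omega>) = drop_entry n i (train t n \<omega>)"
      using i by (auto simp: train_def sample_def drop_entry_def restrict_def fun_eq_iff)
    moreover have "sample t n \<omega> i = train t n \<omega> i"
      using i by (simp add: train_def sample_def)
    ultimately show ?thesis by (simp add: r_def loo_score_def)
  qed
  have test: "loo_score (C n n) (Suc n) (sample t n \<omega>) (Suc n) = test_score C t n \<omega>" for \<omega>
    by (simp add: loo_score_def test_score_def train_eq_restrict(2)) (simp add: sample_def)
  obtain \<kappa> where \<kappa>: "regular_cond_distr (M n) borel (test_score C t n) ?N (train t n) \<kappa>"
    and f: "AE a in distr (M n) ?N (train t n).
      f a \<in> borel_measurable borel \<and> \<kappa> a = density lborel (f a)"
    using dens by (auto simp: has_cond_density_def)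
  have train: "train t n \<in> M n \<rightarrow>\<^sub>M ?N" and test_meas: "test_score C t n \<in> borel_measurable (M n)"
    and \<kappa>_meas: "\<kappa> \<in> ?N \<rightarrow>\<^sub>M prob_algebra borel"
    using \<kappa> by (auto simp: regular_cond_distr_def)
  define h :: "_ \<Rightarrow> ennreal" where "h = (\<lambda>(T, s). indicator {s. \<bar>s - r T\<bar> \<le> d} s)"
  have h: "h \<in> borel_measurable (?N \<Otimes>\<^sub>M borel)"
  proof -
    have "Measurable.pred (?N \<Otimes>\<^sub>M borel) (\<lambda>w. \<bar>snd w - r (fst w)\<bar> \<le> d)"
      using r by measurable
    then have "{w \<in> space (?N \<Otimes>\<^sub>M borel). \<bar>snd w - r (fst w)\<bar> \<le> d} \<in> sets (?N \<Otimes>\<^sub>M borel)"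
      by (simp add: pred_def)
    from borel_measurable_indicator[OF this]
    show ?thesis
      by (rule measurable_cong[THEN iffD1, rotated]) (auto simp: h_def indicator_def)
  qed
  define g where "g T = (\<integral>\<^sup>+s. h (T, s) \<partial>\<kappa> T)" for T
  have g: "g \<in> borel_measurable ?N"
    unfolding g_def
    by (rule nn_integral_measurable_subprob_algebra2[OF _ measurable_prob_algebraD[OF \<kappa>_meas]])
      (use h in simp)
  have near_sets: "{D \<in> space S.Samples. \<bar>S.fc_score D (Suc n) - S.sc_score D i\<bar> \<le> d} \<in> sets S.Samples"
    using S.measurable_fc_score[of "Suc n"] S.measurable_sc_score_Samples[OF i] by measurable
  have "ennreal (S.S.prob {D \<in> space S.Samples. \<bar>S.fc_score D (Suc n) - S.sc_score D i\<bar> \<le> d})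
      = emeasure (M n) {\<omega> \<in> space (M n). \<bar>test_score C t n \<omega> - r (train t n \<omega>)\<bar> \<le> d}"
    using prob_sample[OF n1 near_sets]
    by (simp only: S.fc_score_def S.sc_score_def r_train test M.emeasure_eq_measure)
  also have "\<dots> = (\<integral>\<^sup>+\<omega>. indicator {\<omega> \<in> space (M n). \<bar>test_score C t n \<omega> - r (train t n \<omega>)\<bar> \<le> d} \<omega> \<partial>M n)"
    using test_meas measurable_compose[OF train r] by (intro nn_integral_indicator[symmetric]) measurable
  also have "\<dots> = (\<integral>\<^sup>+\<omega>. h (train t n \<omega>, test_score C t n \<omega>) \<partial>M n)"
    by (intro nn_integral_cong) (auto simp: h_def indicator_def)
  also have "\<dots> = (\<integral>\<^sup>+T. g T \<partial>distr (M n) ?N (train t n))"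
    unfolding g_def by (rule regular_cond_distr_nn_integral[OF M.prob_space_axioms \<kappa> h])
  also have "\<dots> = (\<integral>\<^sup>+\<omega>. g (train t n \<omega>) \<partial>M n)"
    by (rule nn_integral_distr[OF train, unfolded measurable_distr_eq1, OF g])
  also have "\<dots> \<le> (\<integral>\<^sup>+\<omega>. indicator A \<omega> + ennreal (2 * K * d) \<partial>M n)"
  proof (rule nn_integral_mono_AE)
    show "AE \<omega> in M n. g (train t n \<omega>) \<le> indicator A \<omega> + ennreal (2 * K * d)"
      using AE_distrD[OF train f] AE_space
    proof eventually_elim
      case (elim \<omega>)
      let ?T = "train t n \<omega>"
      have T: "?T \<in> space ?N" using measurable_space[OF train elim(2)] .
      show ?case
      proof (cases "\<omega> \<in> A")
        case True
        have "\<kappa> ?T \<in> space (prob_algebra borel)"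
          using measurable_space[OF \<kappa>_meas T] .
        then have p: "prob_space (\<kappa> ?T)" by (simp add: space_prob_algebra)
        have "g ?T \<le> (\<integral>\<^sup>+s. 1 \<partial>\<kappa> ?T)"
          unfolding g_def by (intro nn_integral_mono) (auto simp: h_def indicator_def)
        also have "\<dots> = 1" using prob_space.emeasure_space_1[OF p] by simp
        finally have "g ?T \<le> 1" .
        then show ?thesis using True by (simp add: add_increasing2)
      next
        case False
        have f_le: "f ?T s \<le> ennreal K" for s
          using bound[of \<omega>] False elim(2) SUP_upper[of s UNIV "f ?T"] by (auto intro: order_trans)
        have h_T: "(\<lambda>s. h (?T, s)) \<in> borel_measurable borel"
          by (rule measurable_compose[OF measurable_Pair1'[OF T] h])
        have "g ?T = (\<integral>\<^sup>+s. f ?T s * h (?T, s) \<partial>lborel)"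
          using elim(1) h_T by (simp add: g_def nn_integral_density)
        also have "\<dots> \<le> (\<integral>\<^sup>+s. ennreal K * indicator {r ?T - d .. r ?T + d} s \<partial>lborel)"
          using f_le by (intro nn_integral_mono) (auto simp: h_def indicator_def abs_le_iff intro: mult_mono)
        also have "\<dots> = ennreal K * ennreal (2 * d)"
          using d by (subst nn_integral_cmult_indicator) auto
        also have "\<dots> = ennreal (2 * K * d)"
          using K d by (simp add: ennreal_mult[symmetric] mult.assoc mult.left_commute)
        finally show ?thesis using False by simp
      qed
    qed
  qed
  also have "\<dots> = emeasure (M n) A + ennreal (2 * K * d)"
    using A by (simp add: nn_integral_add M.emeasure_space_1)
  also have "\<dots> = ennreal (measure (M n) A + 2 * K * d)"
    using K d by (simp add: M.emeasure_eq_measure ennreal_plus)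
  finally show ?thesis
    unfolding S.fc_score_def S.sc_score_def using K d by (subst (asm) ennreal_le_iff) simp_all
qed

lemma eventually_sample_size:
  assumes "\<epsilon> > 0"
  shows "eventually (\<lambda>n. 2 \<le> n \<and> 1 / real n \<le> \<epsilon> / 2) sequentially"
proof -
  have "(\<lambda>n. 1 / real n) \<longlonglongrightarrow> 0" by (rule lim_1_over_n)
  then have "eventually (\<lambda>n. 1 / real n < \<epsilon> / 2) sequentially"
    using assms by (intro order_tendstoD(2)) auto
  with eventually_ge_at_top[of 2] show ?thesis
    by eventually_elim simp
qed

lemma expected_length_difference_tendsto:
  assumes "\<delta>1 < \<delta>2" and \<epsilon>: "\<epsilon> > 0"
    and differ: "\<And>n \<omega> y. n \<ge> 2 \<Longrightarrow> 1 / real n \<le> \<epsilon> / 2 \<Longrightarrow> y \<in> A n \<omega> \<Longrightarrow> y \<in> Y n \<and>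
      sample_scores.deviates n (C n n) (C n (n - 1)) \<epsilon> (\<delta>2 - \<delta>1) (new_response n (sample t n \<omega>) y)"
  shows "(\<lambda>n. \<integral>\<^sup>+\<omega>. emeasure lborel (A n \<omega>) \<partial>M n) \<longlonglongrightarrow> 0"
proof -
  let ?d = "\<delta>2 - \<delta>1"
  let ?b = "\<lambda>n. 1 / f0 * (2 / \<epsilon> * instab n ?d)"
  have le: "eventually (\<lambda>n. (\<integral>\<^sup>+\<omega>. emeasure lborel (A n \<omega>) \<partial>M n) \<le> ennreal (?b n)) sequentially"
    using eventually_sample_size[OF \<epsilon>]
  proof eventually_elim
    case (elim n)
    then interpret S: sample_scores "P n" n "C n n" "C n (n - 1)"
      by (intro sample_scores) simp
    have "(\<integral>\<^sup>+\<omega>. emeasure lborel (A n \<omega>) \<partial>M n)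
        \<le> ennreal (1 / f0 * S.S.prob {D \<in> space S.Samples. S.deviates \<epsilon> ?d D})"
      using elim by (intro length_le S.pred_deviates differ) auto
    also have "\<dots> \<le> ennreal (?b n)"
      using f0_pos by (intro ennreal_leI mult_left_mono S.prob_deviates \<epsilon>) simp
    finally show ?case .
  qed
  have "?b \<longlonglongrightarrow> 1 / f0 * (2 / \<epsilon> * 0)"
    using assms(1) by (intro tendsto_mult tendsto_const instab_tendsto) simp
  then have "(\<lambda>n. ennreal (?b n)) \<longlonglongrightarrow> 0"
    using tendsto_ennrealI[of ?b 0 sequentially] by simp
  from tendsto_sandwich[OF _ le tendsto_const this] show ?thesis by simp
qed

lemma general_case:
  assumes "\<delta>1 < \<delta>2" and \<epsilon>: "\<epsilon> > 0"
  shows "(\<lambda>n. \<integral>\<^sup>+\<omega>. emeasure lborel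
      (PS_fc Y C t n \<alpha> \<delta>1 \<omega> - PS_sc Y C t n (\<alpha> - \<epsilon>) \<delta>2 \<omega>) \<partial>M n) \<longlonglongrightarrow> 0"
    and "(\<lambda>n. \<integral>\<^sup>+\<omega>. emeasure lborel
      (PS_sc Y C t n (\<alpha> + \<epsilon>) \<delta>1 \<omega> - PS_fc Y C t n \<alpha> \<delta>2 \<omega>) \<partial>M n) \<longlonglongrightarrow> 0"
proof -
  have dev: "sample_scores.deviates n (C n n) (C n (n - 1)) \<epsilon> (\<delta>2 - \<delta>1) D \<longleftrightarrow>
      \<not> (\<Sum>i=1..n. of_bool (\<bar>loo_score (C n n) (Suc n) D i - loo_score (C n (n - 1)) n D i\<bar> > \<delta>2 - \<delta>1))
        \<le> real n * \<epsilon> / 2" if "n \<ge> 2" for n D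
  proof -
    interpret S: sample_scores "P n" n "C n n" "C n (n - 1)"
      using that by (rule sample_scores)
    show ?thesis by (simp only: S.deviates_def S.fc_score_def S.sc_score_def not_le)
  qed
  show "(\<lambda>n. \<integral>\<^sup>+\<omega>. emeasure lborel
      (PS_fc Y C t n \<alpha> \<delta>1 \<omega> - PS_sc Y C t n (\<alpha> - \<epsilon>) \<delta>2 \<omega>) \<partial>M n) \<longlonglongrightarrow> 0"
  proof (rule expected_length_difference_tendsto[OF assms])
    fix n \<omega> y
    assume n: "n \<ge> 2" "1 / real n \<le> \<epsilon> / 2"
      and y: "y \<in> PS_fc Y C t n \<alpha> \<delta>1 \<omega> - PS_sc Y C t n (\<alpha> - \<epsilon>) \<delta>2 \<omega>"
    have n1: "n \<ge> 1" using n by simp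
    show "y \<in> Y n \<and> sample_scores.deviates n (C n n) (C n (n - 1)) \<epsilon> (\<delta>2 - \<delta>1)
        (new_response n (sample t n \<omega>) y)"
      using y prediction_inclusion(1)[OF n1 n(2)] unfolding dev[OF n(1)] Diff_iff PS_iff by blast
  qed
  show "(\<lambda>n. \<integral>\<^sup>+\<omega>. emeasure lborel
      (PS_sc Y C t n (\<alpha> + \<epsilon>) \<delta>1 \<omega> - PS_fc Y C t n \<alpha> \<delta>2 \<omega>) \<partial>M n) \<longlonglongrightarrow> 0"
  proof (rule expected_length_difference_tendsto[OF assms])
    fix n \<omega> y
    assume n: "n \<ge> 2" "1 / real n \<le> \<epsilon> / 2"
      and y: "y \<in> PS_sc Y C t n (\<alpha> + \<epsilon>) \<delta>1 \<omega> - PS_fc Y C t n \<alpha> \<delta>2 \<omega>"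
    have n1: "n \<ge> 1" using n by simp
    show "y \<in> Y n \<and> sample_scores.deviates n (C n n) (C n (n - 1)) \<epsilon> (\<delta>2 - \<delta>1)
        (new_response n (sample t n \<omega>) y)"
      using y prediction_inclusion(2)[OF n1 n(2)] unfolding dev[OF n(1)] Diff_iff PS_iff by blast
  qed
qed

lemma sym_diff_length_le:
  assumes n: "n \<ge> 2" "1 / real n \<le> \<epsilon> / 2" and \<epsilon>: "\<epsilon> > 0" and d: "d > 0"
    and close: "\<And>i. i \<in> {1..n} \<Longrightarrow> measure (PiM {1..Suc n} (\<lambda>_. P n)) {D \<in> space (PiM {1..Suc n} (\<lambda>_. P n)).
      \<bar>loo_score (C n n) (Suc n) D (Suc n) - loo_score (C n (n - 1)) n D i\<bar> \<le> 3 * d} \<le> \<kappa>"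
  shows "(\<integral>\<^sup>+\<omega>. emeasure lborel (sym_diff (PS_fc Y C t n \<alpha> 0 \<omega>) (PS_sc Y C t n \<alpha> 0 \<omega>)) \<partial>M n)
    \<le> ennreal (1 / f0 * (4 * \<epsilon> + 2 / \<epsilon> * (1 / real (Suc n) + 2 * instab n d + \<kappa>)))"
proof -
  interpret S: sample_scores "P n" n "C n n" "C n (n - 1)"
    using n(1) by (rule sample_scores)
  have n1: "n \<ge> 1" using n by simp
  define dev where "dev = S.deviates \<epsilon> d"
  define str where "str D = straddles (Suc n) (S.fc_score D) (1 - \<alpha>) \<epsilon> (2 * d) (Suc n)" for D
  have dev: "Measurable.pred S.Samples dev"
    unfolding dev_def by (rule S.pred_deviates)
  have str: "Measurable.pred S.Samples str"
    unfolding str_def by (rule S.pred_straddles) simp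
  have sets: "{D \<in> space S.Samples. dev D} \<in> sets S.Samples"
    "{D \<in> space S.Samples. str D} \<in> sets S.Samples"
    using dev str by (simp_all only: pred_def)
  have incl: "y \<in> Y n \<and> (dev (new_response n (sample t n \<omega>) y) \<or> str (new_response n (sample t n \<omega>) y))"
    if y: "y \<in> sym_diff (PS_fc Y C t n \<alpha> 0 \<omega>) (PS_sc Y C t n \<alpha> 0 \<omega>)" for \<omega> y
  proof (rule conjI)
    let ?D = "new_response n (sample t n \<omega>) y"
    show "y \<in> Y n" using y by (auto simp: PS_iff)
    have "str ?D" if "\<not> dev ?D"
    proof -
      from that have "(\<Sum>i=1..n. of_bool (\<bar>S.fc_score ?D i - S.sc_score ?D i\<bar> > d)) \<le> real n * \<epsilon> / 2"
        by (simp only: dev_def S.deviates_def not_less)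
      moreover have "(ereal (S.fc_score ?D (Suc n)) \<le> quantile (emp_cdf (Suc n) (S.fc_score ?D)) (1 - \<alpha>) + ereal 0)
          \<noteq> (ereal (S.fc_score ?D (Suc n)) \<le> quantile (emp_cdf n (S.sc_score ?D)) (1 - \<alpha>) + ereal 0)"
        using y unfolding Un_iff Diff_iff PS_iff S.fc_score_def S.sc_score_def by blast
      ultimately show "str ?D"
        unfolding str_def by (rule sym_diff_imp_straddles[OF n1 n(2) d])
    qed
    then show "dev ?D \<or> str ?D" by blast
  qed
  have "Measurable.pred S.Samples (\<lambda>D. dev D \<or> str D)"
    using dev str by measurable
  then have "(\<integral>\<^sup>+\<omega>. emeasure lborel (sym_diff (PS_fc Y C t n \<alpha> 0 \<omega>) (PS_sc Y C t n \<alpha> 0 \<omega>)) \<partial>M n)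
      \<le> ennreal (1 / f0 * S.S.prob {D \<in> space S.Samples. dev D \<or> str D})"
    using incl by (rule length_le[OF n(1)])
  also have "\<dots> \<le> ennreal (1 / f0 * (4 * \<epsilon> + 2 / \<epsilon> * (1 / real (Suc n) + 2 * instab n d + \<kappa>)))"
  proof (intro ennreal_leI mult_left_mono)
    have "S.S.prob {D \<in> space S.Samples. dev D \<or> str D}
        = S.S.prob ({D \<in> space S.Samples. dev D} \<union> {D \<in> space S.Samples. str D})"
      by (rule arg_cong[where f = S.S.prob]) blast
    also have "\<dots> \<le> S.S.prob {D \<in> space S.Samples. dev D} + S.S.prob {D \<in> space S.Samples. str D}"
      using sets by (rule measure_Un_le)
    also have "\<dots> \<le> 2 / \<epsilon> * instab n d + (4 * \<epsilon> + 2 / \<epsilon> * (1 / real (Suc n) + instab n d + \<kappa>))"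
      unfolding dev_def str_def using d close
      by (intro add_mono S.prob_deviates S.prob_straddles \<epsilon>) (simp_all only: S.fc_score_def S.sc_score_def less_imp_le)
    also have "\<dots> = 4 * \<epsilon> + 2 / \<epsilon> * (1 / real (Suc n) + 2 * instab n d + \<kappa>)"
      by (simp only: distrib_left)
    finally show "S.S.prob {D \<in> space S.Samples. dev D \<or> str D}
        \<le> 4 * \<epsilon> + 2 / \<epsilon> * (1 / real (Suc n) + 2 * instab n d + \<kappa>)" .
  qed (use f0_pos in simp)
  finally show ?thesis .
qed

lemma continuous_case:
  assumes CC: "CC Y p M t C"
  shows "(\<lambda>n. \<integral>\<^sup>+\<omega>. emeasure lborel
    (sym_diff (PS_fc Y C t n \<alpha> 0 \<omega>) (PS_sc Y C t n \<alpha> 0 \<omega>)) \<partial>M n) \<longlonglongrightarrow> 0"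
proof (rule ennreal_tendsto_0I)
  fix \<gamma> :: real assume \<gamma>: "\<gamma> > 0"
  \<comment> \<open>The bound below tends to \<open>8 \<epsilon> / f0\<close>, which is smaller than \<open>\<gamma>\<close>.\<close>
  define \<epsilon> where "\<epsilon> = \<gamma> * f0 / 9"
  have \<epsilon>: "\<epsilon> > 0" using \<gamma> f0_pos by (simp add: \<epsilon>_def)
  obtain f where dens: "\<And>n. n \<ge> 1 \<Longrightarrow> has_cond_density (M n) (test_score C t n)
                  (tuple_space (Y n) (p n) n) (train t n) (f n)"
    and bounded: "stochastically_bounded M (\<lambda>n \<omega>. SUP s. f n (train t n \<omega>) s)"
    using CC by (auto simp: CC_def)
  obtain K0 :: real where K0: "\<And>n. n \<ge> 1 \<Longrightarrow> \<exists>A\<in>sets (M n). measure (M n) A \<le> \<epsilon>\<^sup>2 \<and>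
      (\<forall>\<omega>\<in>space (M n) - A. (SUP s. f n (train t n \<omega>) s) \<le> ennreal K0)"
    using bounded \<epsilon> unfolding stochastically_bounded_def by (meson zero_less_power)
  define K where "K = max K0 0"
  have K: "K \<ge> 0" "ennreal K0 \<le> ennreal K" by (auto simp: K_def intro: ennreal_leI)
  \<comment> \<open>Given the training sample, the new score falls into an interval of length \<open>6 d\<close> with
    probability at most \<open>6 K d \<le> \<epsilon>\<^sup>2\<close>, outside an event of probability \<open>\<epsilon>\<^sup>2\<close>.\<close>
  define d where "d = \<epsilon>\<^sup>2 / (6 * (K + 1))"
  have d: "d > 0" using \<epsilon> K by (simp add: d_def)
  have Kd: "6 * K * d \<le> \<epsilon>\<^sup>2"
  proof -
    have "6 * K * d \<le> 6 * (K + 1) * d" using d by (intro mult_right_mono) auto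
    also have "\<dots> = \<epsilon>\<^sup>2" using K by (simp add: d_def)
    finally show ?thesis .
  qed
  let ?b = "\<lambda>n. 1 / f0 * (4 * \<epsilon> + 2 / \<epsilon> * (1 / real (Suc n) + 2 * instab n d + 2 * \<epsilon>\<^sup>2))"
  have "?b \<longlonglongrightarrow> 1 / f0 * (4 * \<epsilon> + 2 / \<epsilon> * (0 + 2 * 0 + 2 * \<epsilon>\<^sup>2))"
    using LIMSEQ_Suc[OF lim_1_over_n]
    by (intro tendsto_mult tendsto_add tendsto_const instab_tendsto d) simp
  moreover have "1 / f0 * (4 * \<epsilon> + 2 / \<epsilon> * (0 + 2 * 0 + 2 * \<epsilon>\<^sup>2)) < \<gamma>"
  proof -
    have "1 / f0 * (4 * \<epsilon> + 2 / \<epsilon> * (0 + 2 * 0 + 2 * \<epsilon>\<^sup>2)) = 1 / f0 * (8 * \<epsilon>)"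
      using \<epsilon> by (simp add: power2_eq_square)
    also have "\<dots> < \<gamma>" using f0_pos \<gamma> by (simp add: \<epsilon>_def)
    finally show ?thesis .
  qed
  ultimately have "eventually (\<lambda>n. ?b n < \<gamma>) sequentially"
    by (rule order_tendstoD(2))
  then show "eventually (\<lambda>n. (\<integral>\<^sup>+\<omega>. emeasure lborel
    (sym_diff (PS_fc Y C t n \<alpha> 0 \<omega>) (PS_sc Y C t n \<alpha> 0 \<omega>)) \<partial>M n) \<le> ennreal \<gamma>) sequentially"
    using eventually_sample_size[OF \<epsilon>]
  proof eventually_elim
    case (elim n)
    then have n: "n \<ge> 2" "1 / real n \<le> \<epsilon> / 2" "n \<ge> 1" by auto
    obtain A where A: "A \<in> sets (M n)" "measure (M n) A \<le> \<epsilon>\<^sup>2"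
      and bound: "\<And>\<omega>. \<omega> \<in> space (M n) - A \<Longrightarrow> (SUP s. f n (train t n \<omega>) s) \<le> ennreal K0"
      using K0[OF n(3)] by blast
    have "measure (PiM {1..Suc n} (\<lambda>_. P n)) {D \<in> space (PiM {1..Suc n} (\<lambda>_. P n)).
        \<bar>loo_score (C n n) (Suc n) D (Suc n) - loo_score (C n (n - 1)) n D i\<bar> \<le> 3 * d} \<le> 2 * \<epsilon>\<^sup>2"
      if i: "i \<in> {1..n}" for i
    proof -
      have "measure (PiM {1..Suc n} (\<lambda>_. P n)) {D \<in> space (PiM {1..Suc n} (\<lambda>_. P n)).
          \<bar>loo_score (C n n) (Suc n) D (Suc n) - loo_score (C n (n - 1)) n D i\<bar> \<le> 3 * d}
          \<le> measure (M n) A + 2 * K * (3 * d)"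
        using d by (intro prob_close_le[OF n(1) i dens[OF n(3)] A(1) K(1)] order_trans[OF bound K(2)]) auto
      also have "\<dots> \<le> 2 * \<epsilon>\<^sup>2" using A(2) Kd by simp
      finally show ?thesis .
    qed
    then have "(\<integral>\<^sup>+\<omega>. emeasure lborel
        (sym_diff (PS_fc Y C t n \<alpha> 0 \<omega>) (PS_sc Y C t n \<alpha> 0 \<omega>)) \<partial>M n) \<le> ennreal (?b n)"
      by (rule sym_diff_length_le[OF n(1,2) \<epsilon> d])
    also have "\<dots> \<le> ennreal \<gamma>"
      using elim by (intro ennreal_leI) simp
    finally show ?case .
  qed
qed

end


theorem propositionA3:
  fixes Y :: "nat \<Rightarrow> real set"
    and p :: "nat \<Rightarrow> nat"
    and P :: "nat \<Rightarrow> point measure"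
    and M :: "nat \<Rightarrow> 'w measure"
    and t :: "nat \<Rightarrow> nat \<Rightarrow> 'w \<Rightarrow> point"
    and C :: "nat \<Rightarrow> nat \<Rightarrow> score"
    and f0 :: real
  assumes interval: "\<And>n. n \<ge> 1 \<Longrightarrow> is_interval (Y n)"
    and prob_P: "\<And>n. n \<ge> 1 \<Longrightarrow> prob_space (P n)"
    and sets_P: "\<And>n. n \<ge> 1 \<Longrightarrow> sets (P n) = sets (z_space (Y n) (p n))"
    and prob_M: "\<And>n. n \<ge> 1 \<Longrightarrow> prob_space (M n)"
    and indep: "\<And>n. n \<ge> 1 \<Longrightarrow> prob_space.indep_vars (M n) (\<lambda>_. P n) (t n) {1..n + 1}"
    and ident: "\<And>n i. n \<ge> 1 \<Longrightarrow> i \<in> {1..n + 1} \<Longrightarrow> distr (M n) (P n) (t n i) = P n"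
    and scores: "conformity_scores Y p C"
    and stable: "stable_scores M t C"
    and f0_pos: "f0 > 0"
    and cond_density: "\<And>n. n \<ge> 1 \<Longrightarrow>
      \<exists>f. has_cond_density (M n) (\<lambda>\<omega>. fst (t n 1 \<omega>)) (x_space (p n)) (\<lambda>\<omega>. snd (t n 1 \<omega>)) f \<and>
          (AE x in distr (M n) (x_space (p n)) (\<lambda>\<omega>. snd (t n 1 \<omega>)).
             \<forall>y\<in>Y n. f x y \<ge> ennreal f0)"
  shows
    "(\<forall>\<alpha>\<in>{0<..<1}. \<forall>\<delta>1 \<delta>2. \<forall>\<epsilon>\<in>{0<..min \<alpha> (1 - \<alpha>)}. \<delta>1 < \<delta>2 \<longrightarrow>
        (\<lambda>n. \<integral>\<^sup>+ \<omega>. emeasure lborel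
            (PS_fc Y C t n \<alpha> \<delta>1 \<omega> - PS_sc Y C t n (\<alpha> - \<epsilon>) \<delta>2 \<omega>) \<partial>M n) \<longlonglongrightarrow> 0 \<and>
        (\<lambda>n. \<integral>\<^sup>+ \<omega>. emeasure lborel
            (PS_sc Y C t n (\<alpha> + \<epsilon>) \<delta>1 \<omega> - PS_fc Y C t n \<alpha> \<delta>2 \<omega>) \<partial>M n) \<longlonglongrightarrow> 0)
     \<and>
     (CC Y p M t C \<longrightarrow>
      stochastically_bounded M (\<lambda>n \<omega>. ennreal \<bar>test_score C t n \<omega>\<bar>) \<longrightarrow>
      (\<forall>\<alpha>\<in>{0..1}.
        (\<lambda>n. \<integral>\<^sup>+ \<omega>. emeasure lborel
            (sym_diff (PS_fc Y C t n \<alpha> 0 \<omega>) (PS_sc Y C t n \<alpha> 0 \<omega>)) \<partial>M n) \<longlonglongrightarrow> 0))"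
proof -
  interpret conformal_model Y p P M t C f0
    using assms by (rule conformal_model.intro)
  show ?thesis
    using general_case continuous_case by simp
qed

end
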